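(* For any $t\in[0,1]$, there exists a Moran spectral measure $\mu$ (that is, a Moran measure that is also a spectral measure) such that $$\dim_L \mu=\dim_H \mu=\dim_P\mu=\dim_A\mu=t.$$
   Context: A compactly supported Borel probability measure $\mu$ on $\mathbb{R}^d$ is called a spectral measure if there is a countable set $\Lambda\subseteq\mathbb{R}^d$ such that $\{e^{-2\pi i\langle\lambda,x\rangle}:\lambda\in\Lambda\}$ is an orthonormal basis of $L^2(\mu)$. Given sequences of integers $\{b_n\}_{n\ge1}$, $\{q_n\}_{n\ge1}$ with $2\le q_n<b_n$, put $\mathcal{D}_k=\{0,1,\ldots,q_k-1\}$ for $k\ge1$. The associated Moran measure is the Borel probability measure on $\mathbb{R}$ given by the infinite convolution (weak limit of the finite convolutions) $$\mu=\delta_{b_1^{-1}\mathcal{D}_1}\ast \delta_{(b_1b_2)^{-1}\mathcal{D}_2}\ast\cdots \ast \delta_{(b_1b_2\cdots b_k)^{-1}\mathcal{D}_k}\ast\cdots,$$ where for a finite set $\mathcal{E}\subset\mathbb{R}$, $\delta_{\mathcal{E}}=\frac{1}{\#\mathcal{E}}\sum_{e\in\mathcal{E}}\delta_e$ and $\delta_e$ is the Dirac measure at $e$. A Moran measure is any measure of this form. Let $|\mathrm{supp}(\mu)|$ denote the diameter of the support of $\mu$ and $B(x,r)$ the ball of center $x$ and radius $r$. The Assouad dimension $\dim_A\mu$ is the infimum of all $s\ge 0$ for which there exists a constant $C>0$ such that for all $0<r<R<|\mathrm{supp}(\mu)|$ and all $x\in\mathrm{supp}(\mu)$, $\frac{\mu(B(x,R))}{\mu(B(x,r))}\le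 C\left(\frac{R}{r}\right)^s$. The lower dimension $\dim_L\mu$ is the supremum of all $s\ge 0$ for which there exists a constant $C>0$ such that for all $0<r<R<|\mathrm{supp}(\mu)|$ and all $x\in\mathrm{supp}(\mu)$, $\frac{\mu(B(x,R))}{\mu(B(x,r))}\ge C\left(\frac{R}{r}\right)^s$. The Hausdorff dimension and packing dimension of the measure $\mu$ are $\dim_H\mu=\inf\{\dim_H E: E \text{ Borel},\ \mu(E)>0\}$ and $\dim_P\mu=\inf\{\dim_P E: E \text{ Borel},\ \mu(E)>0\}$, where $\dim_H E$ and $\dim_P E$ are the Hausdorff and packing dimensions of the set $E$. *)

theory Defs
  imports "HOL-Probability.Probability"
begin

section \<open>Moran measures\<close>

definition uniform_dirac :: "real set \<Rightarrow> real measure" where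
  "uniform_dirac E = distr (measure_pmf (pmf_of_set E)) borel (\<lambda>x. x)"

text \<open>
  The sequences are indexed from 1; \<open>b 0\<close> and \<open>q 0\<close> are never used.  The empty convolution is the
  Dirac measure at 0, which is the neutral element of convolution.
\<close>

definition moran_digits :: "(nat \<Rightarrow> nat) \<Rightarrow> (nat \<Rightarrow> nat) \<Rightarrow> nat \<Rightarrow> real set" where
  "moran_digits b q k = (\<lambda>d. real d / (\<Prod>j=1..k. real (b j))) ` {0..<q k}"

primrec moran_convolution :: "(nat \<Rightarrow> nat) \<Rightarrow> (nat \<Rightarrow> nat) \<Rightarrow> nat \<Rightarrow> real measure" where
  "moran_convolution b q 0 = return borel 0"
| "moran_convolution b q (Suc k) =
     convolution (moran_convolution b q k) (uniform_dirac (moran_digits b q (Suc k)))"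

definition moran_measure :: "real measure \<Rightarrow> bool" where
  "moran_measure M \<longleftrightarrow> real_distribution M \<and>
     (\<exists>b q. (\<forall>n\<ge>1. 2 \<le> q n \<and> q n < b n) \<and> weak_conv_m (moran_convolution b q) M)"


section \<open>Spectral measures\<close>

definition measure_support :: "'a::topological_space measure \<Rightarrow> 'a set" where
  "measure_support M = {x. \<forall>U. open U \<and> x \<in> U \<longrightarrow> emeasure M U > 0}"

definition L2_functions :: "'a measure \<Rightarrow> ('a \<Rightarrow> complex) set" where
  "L2_functions M = {f \<in> borel_measurable M. integrable M (\<lambda>x. (cmod (f x))\<^sup>2)}"

definition L2_inner :: "'a measure \<Rightarrow> ('a \<Rightarrow> complex) \<Rightarrow> ('a \<Rightarrow> complex) \<Rightarrow> complex" where
  "L2_inner M f g = (LINT x|M. f x * cnj (g x))"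

definition L2_norm :: "'a measure \<Rightarrow> ('a \<Rightarrow> complex) \<Rightarrow> real" where
  "L2_norm M f = sqrt (LINT x|M. (cmod (f x))\<^sup>2)"

text \<open>
  An orthonormal basis in the Hilbert space sense: an orthonormal family, indexed by \<open>I\<close>, of
  square-integrable functions whose linear span is dense.
\<close>

definition L2_orthonormal_basis :: "'a measure \<Rightarrow> 'i set \<Rightarrow> ('i \<Rightarrow> 'a \<Rightarrow> complex) \<Rightarrow> bool" where
  "L2_orthonormal_basis M I e \<longleftrightarrow>
     (\<forall>i\<in>I. e i \<in> L2_functions M) \<and>
     (\<forall>i\<in>I. \<forall>j\<in>I. L2_inner M (e i) (e j) = (if i = j then 1 else 0)) \<and>
     (\<forall>f\<in>L2_functions M. \<forall>\<epsilon>>0. \<exists>J c. finite J \<and> J \<subseteq> I \<and>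
        L2_norm M (\<lambda>x. f x - (\<Sum>j\<in>J. c j * e j x)) < \<epsilon>)"

definition spectral_measure :: "'a::euclidean_space measure \<Rightarrow> bool" where
  "spectral_measure M \<longleftrightarrow>
     prob_space M \<and> sets M = sets borel \<and> compact (measure_support M) \<and>
     (\<exists>\<Lambda>. countable \<Lambda> \<and>
        L2_orthonormal_basis M \<Lambda> (\<lambda>l x. exp (- 2 * of_real pi * \<i> * of_real (l \<bullet> x))))"


section \<open>Assouad and lower dimension of a measure\<close>

text \<open>
  The diameter of an unbounded set is unspecified in HOL, so these two definitions are only
  meaningful for measures with bounded support.
\<close>

definition assouad_dim :: "'a::metric_space measure \<Rightarrow> ereal" where
  "assouad_dim M = Inf {ereal s | s. 0 \<le> s \<and>
     (\<exists>C>0. \<forall>r R. 0 < r \<and> r < R \<and> R < diameter (measure_support M) \<longrightarrow>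
        (\<forall>x\<in>measure_support M.
           measure M (ball x R) / measure M (ball x r) \<le> C * (R / r) powr s))}"

definition lower_dim :: "'a::metric_space measure \<Rightarrow> ereal" where
  "lower_dim M = Sup {ereal s | s. 0 \<le> s \<and>
     (\<exists>C>0. \<forall>r R. 0 < r \<and> r < R \<and> R < diameter (measure_support M) \<longrightarrow>
        (\<forall>x\<in>measure_support M.
           measure M (ball x R) / measure M (ball x r) \<ge> C * (R / r) powr s))}"


section \<open>Hausdorff dimension\<close>

text \<open>
  The \<open>s\<close>-th power of the diameter, with value 1 for nonempty sets when \<open>s = 0\<close>
  (whereas \<open>0 powr 0 = 0\<close> in HOL) and value 0 for the empty set.
\<close>

definition diameter_power :: "real \<Rightarrow> 'a::metric_space set \<Rightarrow> ennreal" where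
  "diameter_power s U =
     (if U = {} then 0 else if s = 0 then 1 else ennreal (diameter U powr s))"

definition hausdorff_premeasure :: "real \<Rightarrow> real \<Rightarrow> 'a::metric_space set \<Rightarrow> ennreal" where
  "hausdorff_premeasure s \<delta> E =
     (INF U\<in>{U :: nat \<Rightarrow> 'a set. E \<subseteq> (\<Union>i. U i) \<and> (\<forall>i. bounded (U i) \<and> diameter (U i) \<le> \<delta>)}.
        \<Sum>i. diameter_power s (U i))"

definition hausdorff_measure :: "real \<Rightarrow> 'a::metric_space set \<Rightarrow> ennreal" where
  "hausdorff_measure s E = (SUP \<delta>\<in>{0<..}. hausdorff_premeasure s \<delta> E)"

definition hausdorff_dim :: "'a::metric_space set \<Rightarrow> ereal" where
  "hausdorff_dim E = Inf {ereal s | s. 0 \<le> s \<and> hausdorff_measure s E = 0}"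

definition measure_hausdorff_dim :: "'a::metric_space measure \<Rightarrow> ereal" where
  "measure_hausdorff_dim M = (INF E\<in>{E \<in> sets borel. emeasure M E > 0}. hausdorff_dim E)"


section \<open>Packing dimension\<close>

text \<open>A packing is given as a set of pairs (centre, radius) of disjoint closed balls.\<close>

definition packings :: "real \<Rightarrow> 'a::metric_space set \<Rightarrow> ('a \<times> real) set set" where
  "packings \<delta> E = {P. countable P \<and> (\<forall>(x, r)\<in>P. x \<in> E \<and> 0 < r \<and> r \<le> \<delta>) \<and>
     disjoint_family_on (\<lambda>(x, r). cball x r) P}"

definition packing_content :: "real \<Rightarrow> real \<Rightarrow> 'a::metric_space set \<Rightarrow> ennreal" where
  "packing_content s \<delta> E =
     (SUP P\<in>packings \<delta> E. \<Sum>\<^sub>\<infinity>(x, r)\<in>P. ennreal ((2 * r) powr s))"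

definition packing_premeasure :: "real \<Rightarrow> 'a::metric_space set \<Rightarrow> ennreal" where
  "packing_premeasure s E = (INF \<delta>\<in>{0<..}. packing_content s \<delta> E)"

text \<open>The premeasure is not countably subadditive, hence the additional infimum over covers.\<close>

definition packing_measure :: "real \<Rightarrow> 'a::metric_space set \<Rightarrow> ennreal" where
  "packing_measure s E =
     (INF A\<in>{A :: nat \<Rightarrow> 'a set. E \<subseteq> (\<Union>i. A i)}. \<Sum>i. packing_premeasure s (A i))"

definition packing_dim :: "'a::metric_space set \<Rightarrow> ereal" where
  "packing_dim E = Inf {ereal s | s. 0 \<le> s \<and> packing_measure s E = 0}"

definition measure_packing_dim :: "'a::metric_space measure \<Rightarrow> ereal" where
  "measure_packing_dim M = (INF E\<in>{E \<in> sets borel. emeasure M E > 0}. packing_dim E)"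

end

theory Submission
  imports Defs
begin

text \<open>
  The measure is the law \<open>\<mu>\<close> of \<open>\<Sum>k\<in>S. \<omega> k / 2 ^ (k + 1)\<close> with independent fair bits \<open>\<omega> k\<close>, where
  \<open>S\<close> is an infinite and co-infinite set of binary positions whose density in every window is \<open>t\<close>, up to
  an error that is small relative to the length of the window. A dyadic interval of length \<open>1 / 2 ^ n\<close> that
  meets the support has measure \<open>1 / 2 ^ card (S \<inter> {..<n})\<close>, so the ratio of the measures of two
  concentric balls is a power of the ratio of the radii with exponent arbitrarily close to \<open>t\<close>, which
  determines all four dimensions. Grouping the positions into gaps followed by maximal runs of \<open>S\<close> exhibits
  \<open>\<mu>\<close> as a Moran measure whose \<open>b n\<close> and \<open>q n\<close> are powers of two with \<open>q n\<close> dividing \<open>b n\<close>. The sums of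
  the numbers \<open>2 ^ k\<close> over finite subsets of \<open>S\<close> are a spectrum.
\<close>

section \<open>Dimensions from ball ratios\<close>

text \<open>The endpoints shape the construction. For t = 1 the set of all positions leaves no room
  for \<open>q n < b n\<close>; for t = 0 a finite set cannot supply infinitely many digits with
  \<open>2 \<le> q n\<close>. The density therefore reaches t only in the limit. This is harmless: a
  dimension sees exponents only up to an arbitrarily small loss, and a bounded error in the digit
  count is a constant factor in the measure. Base two makes orthogonality elementary: adding
  \<open>2 ^ n\<close> to a frequency turns the newest squared cosine into a squared sine and leaves
  the older ones alone. The hard point is completeness, where the mass of the squared Fourier
  coefficients could escape to ever larger frequencies. The gaps prevent this: if levels are cut
  only at positions outside S, the factors beyond the cut have a product bounded below on all
  frequencies of the level. So gaps serve twice, for \<open>q n < b n\<close> and for the spectrum.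
  Once every exponential lies in the closed span, approximation carries over to continuous
  functions, Borel indicators and all of L2.\<close>

lemma Inf_ereal_threshold:
  fixes t :: real
  assumes "\<And>s. t < s \<Longrightarrow> P s" and "\<And>s. P s \<Longrightarrow> t \<le> s"
  shows "Inf {ereal s | s. P s} = ereal t"
proof (rule antisym)
  show "ereal t \<le> Inf {ereal s | s. P s}"
    using assms(2) by (auto intro!: Inf_greatest)
  show "Inf {ereal s | s. P s} \<le> ereal t"
  proof (rule ereal_le_epsilon2)
    fix e :: real assume "0 < e"
    then have "P (t + e)" by (intro assms(1)) simp
    then show "Inf {ereal s | s. P s} \<le> ereal t + ereal e"
      by (auto intro!: Inf_lower)
  qed
qed

text \<open>\<open>P 0\<close> is a separate premise because for t = 0 no exponent lies strictly
  between 0 and t.\<close>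

lemma Sup_ereal_threshold:
  fixes t :: real
  assumes "0 \<le> t" "P 0" "\<And>s. 0 < s \<Longrightarrow> s < t \<Longrightarrow> P s" and "\<And>s. P s \<Longrightarrow> s \<le> t"
  shows "Sup {ereal s | s. P s} = ereal t"
proof (rule antisym)
  show "Sup {ereal s | s. P s} \<le> ereal t"
    using assms(4) by (auto intro!: Sup_least)
  show "ereal t \<le> Sup {ereal s | s. P s}"
  proof (cases "t = 0")
    case True
    then show ?thesis using assms(2) by (auto intro!: Sup_upper)
  next
    case False
    show ?thesis
    proof (rule ereal_le_epsilon2)
      fix e :: real assume "0 < e"
      define s where "s = max (t / 2) (t - e / 2)"
      have "P s"
        using assms(1) False \<open>0 < e\<close> by (intro assms(3)) (auto simp: s_def)
      then have "ereal s \<le> Sup {ereal s | s. P s}" by (auto intro!: Sup_upper)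
      moreover have "t \<le> s + e" using \<open>0 < e\<close> unfolding s_def by linarith
      then have "ereal t \<le> ereal s + ereal e" by simp
      ultimately show "ereal t \<le> Sup {ereal s | s. P s} + ereal e"
        by (meson add_right_mono order_trans)
    qed
  qed
qed

text \<open>Supplies a ratio of radii for which a positive difference p of exponents beats a given
  quotient c of constants.\<close>

lemma powr_unbounded:
  fixes p c :: real
  assumes "0 < p"
  shows "\<exists>u>1. c < u powr p"
proof -
  define u where "u = (max c 1 + 1) powr (1 / p)"
  have "u powr p = max c 1 + 1" using assms by (simp add: u_def powr_powr)
  moreover have "1 < u" unfolding u_def using assms by (intro gr_one_powr) auto
  ultimately show ?thesis by (intro exI[of _ u]) auto
qed

lemma powr_small:
  fixes p c :: real
  assumes "0 < p" "0 < c"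
  shows "\<exists>d>0. d \<le> 1 \<and> d powr p < c"
proof -
  obtain u where u: "1 < u" "1 / c < u powr p" using powr_unbounded[OF assms(1)] by blast
  have "(1 / u) powr p = 1 / u powr p" using u by (simp add: powr_divide)
  also have "\<dots> < c" using u assms by (simp add: field_simps)
  finally show ?thesis using u by (intro exI[of _ "1 / u"]) auto
qed

lemma ennreal_eq_0I:
  fixes x :: ennreal
  assumes "\<And>e. 0 < e \<Longrightarrow> x \<le> ennreal e"
  shows "x = 0"
proof -
  have "x \<le> 0" by (rule ennreal_le_epsilon) (use assms in auto)
  then show ?thesis by simp
qed

lemma ennreal_mult_divide_cancel: "0 < C \<Longrightarrow> ennreal C * (x / ennreal C) = x"
  by (simp add: ennreal_times_divide mult.commute mult_divide_eq_ennreal)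

lemma closed_measure_support: "closed (measure_support M)"
proof -
  have "- measure_support M = \<Union>{U. open U \<and> \<not> emeasure M U > 0}"
    by (auto simp: measure_support_def)
  then show ?thesis by (auto simp: closed_def)
qed

text \<open>Balls of radius \<open>2\<close> contain the whole support, so \<open>R = 2\<close> turns the two ratio bounds into
  bounds for the measure of a single ball.\<close>

locale uniform_dimension = prob_space M for M :: "real measure" +
  fixes t :: real
  assumes sets_M [measurable_cong]: "sets M = sets borel"
    and t_nonneg: "0 \<le> t"
    and support_unit: "measure_support M \<subseteq> {0..1}"
    and support_full: "emeasure M (- measure_support M) = 0"
    and diameter_pos: "0 < diameter (measure_support M)"
    and ratio_le: "\<And>s. t < s \<Longrightarrow> \<exists>C>0. \<forall>x\<in>measure_support M. \<forall>r R. 0 < r \<and> r \<le> R \<and> R \<le> 2 \<longrightarrow>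
      measure M (ball x R) \<le> C * (R / r) powr s * measure M (ball x r)"
    and ratio_ge: "\<And>s. 0 < s \<Longrightarrow> s < t \<Longrightarrow> \<exists>C>0. \<forall>x\<in>measure_support M. \<forall>r R. 0 < r \<and> r \<le> R \<and> R \<le> 2 \<longrightarrow>
      C * (R / r) powr s * measure M (ball x r) \<le> measure M (ball x R)"
begin

abbreviation "K \<equiv> measure_support M"

lemma space_M [simp]: "space M = UNIV"
  using sets_eq_imp_space_eq[OF sets_M] by simp

lemma K_sets [measurable]: "K \<in> sets M"
  using closed_measure_support[of M] by (simp add: sets_M)

lemma ball_pos: "x \<in> K \<Longrightarrow> 0 < r \<Longrightarrow> 0 < measure M (ball x r)"
  by (auto simp: measure_support_def emeasure_eq_measure)

lemma diameter_le_1: "diameter K \<le> 1"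
  using support_unit by (intro diameter_le) (auto simp: subset_iff dist_real_def, smt (verit))

lemma K_nonempty: "K \<noteq> {}"
  using diameter_pos by auto

lemma emeasure_K: "emeasure M K = 1"
proof -
  have "emeasure M (K \<union> - K) = emeasure M K + emeasure M (- K)"
    using closed_measure_support[of M] by (intro plus_emeasure[symmetric]) (auto simp: sets_M)
  then show ?thesis using support_full emeasure_space_1 by simp
qed

lemma emeasure_Int_K: "E \<in> sets M \<Longrightarrow> emeasure M (E \<inter> K) = emeasure M E"
proof -
  assume E: "E \<in> sets M"
  have "AE x in M. x \<in> K"
    using support_full closed_measure_support[of M] 
    by (subst AE_iff_measurable[of "- K"]) (auto simp: sets_M)
  then show ?thesis using E by (intro emeasure_eq_AE) auto
qed

lemma ball_two: "x \<in> K \<Longrightarrow> measure M (ball x 2) = 1"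
proof -
  assume x: "x \<in> K"
  have "K \<subseteq> ball x 2" using support_unit x by (auto simp: dist_real_def subset_iff) (smt (verit))
  then have "measure M K \<le> measure M (ball x 2)"
    by (intro finite_measure_mono) (auto simp: sets_M)
  moreover have "measure M K = 1" using emeasure_K by (simp add: measure_def)
  moreover have "measure M (ball x 2) \<le> 1" by simp
  ultimately show ?thesis by linarith
qed

text \<open>A Frostman condition. \<open>C \<ge> 1\<close> is recorded for s = 0, where the bound
  must dominate the total mass 1.\<close>

lemma ball_le:
  assumes "0 \<le> s" "s < t"
  shows "\<exists>C\<ge>1. \<forall>x\<in>K. \<forall>r. 0 < r \<and> r \<le> 2 \<longrightarrow> measure M (ball x r) \<le> C * r powr s"
proof (cases "s = 0")
  case True
  then show ?thesis by (intro exI[of _ 1]) auto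
next
  case False
  then obtain C where C: "C > 0" "\<And>x r. x \<in> K \<Longrightarrow> 0 < r \<Longrightarrow> r \<le> 2 \<Longrightarrow>
      C * (2 / r) powr s * measure M (ball x r) \<le> measure M (ball x 2)"
    using ratio_ge[of s] assms by force
  have "measure M (ball x r) \<le> max 1 (1 / C) * r powr s" if "x \<in> K" "0 < r" "r \<le> 2" for x r
  proof -
    have "C * measure M (ball x r) * 1 \<le> C * measure M (ball x r) * 2 powr s"
      using C(1) assms by (intro mult_left_mono ge_one_powr_ge_zero) auto
    also have "\<dots> \<le> r powr s"
      using C(2)[OF that] ball_two[OF that(1)] that by (simp add: powr_divide field_simps)
    finally have "measure M (ball x r) \<le> 1 / C * r powr s" using C(1) by (simp add: field_simps)
    also have "\<dots> \<le> max 1 (1 / C) * r powr s" by (intro mult_right_mono) auto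
    finally show ?thesis .
  qed
  then show ?thesis by (intro exI[of _ "max 1 (1 / C)"]) auto
qed

text \<open>The counterpart of the Frostman condition: since every ball centred in the support has a
  guaranteed mass, disjoint balls can be counted by their total mass, at most 1.\<close>

lemma ball_ge:
  assumes "t < s"
  shows "\<exists>c>0. \<forall>x\<in>K. \<forall>r. 0 < r \<and> r \<le> 2 \<longrightarrow> c * r powr s \<le> measure M (ball x r)"
proof -
  obtain C where C: "C > 0" "\<And>x r. x \<in> K \<Longrightarrow> 0 < r \<Longrightarrow> r \<le> 2 \<Longrightarrow>
      measure M (ball x 2) \<le> C * (2 / r) powr s * measure M (ball x r)"
    using ratio_le[of s] assms by force
  have "1 / (C * 2 powr s) * r powr s \<le> measure M (ball x r)" if "x \<in> K" "0 < r" "r \<le> 2" for x r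
    using C(2)[OF that] ball_two[OF that(1)] that C(1) by (simp add: powr_divide field_simps)
  then show ?thesis using C(1) by (intro exI[of _ "1 / (C * 2 powr s)"]) auto
qed

section \<open>Assouad and lower dimension\<close>

lemma assouad_dim_eq: "assouad_dim M = ereal t"
  unfolding assouad_dim_def
proof (rule Inf_ereal_threshold)
  fix s assume "t < s"
  then obtain C where C: "C > 0" "\<And>x r R. x \<in> K \<Longrightarrow> 0 < r \<Longrightarrow> r \<le> R \<Longrightarrow> R \<le> 2 \<Longrightarrow>
      measure M (ball x R) \<le> C * (R / r) powr s * measure M (ball x r)"
    using ratio_le[of s] by blast
  have "measure M (ball x R) / measure M (ball x r) \<le> C * (R / r) powr s"
    if "0 < r" "r < R" "R < diameter K" "x \<in> K" for r R x
    using C(2)[of x r R] that ball_pos[of x r] diameter_le_1 by (simp add: pos_divide_le_eq)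
  then show "0 \<le> s \<and> (\<exists>C>0. \<forall>r R. 0 < r \<and> r < R \<and> R < diameter K \<longrightarrow>
      (\<forall>x\<in>K. measure M (ball x R) / measure M (ball x r) \<le> C * (R / r) powr s))"
    using C(1) \<open>t < s\<close> t_nonneg by (intro conjI exI[of _ C]) auto
next
  fix s assume s: "0 \<le> s \<and> (\<exists>C>0. \<forall>r R. 0 < r \<and> r < R \<and> R < diameter K \<longrightarrow>
      (\<forall>x\<in>K. measure M (ball x R) / measure M (ball x r) \<le> C * (R / r) powr s))"
  then obtain C where C: "C > 0" "\<And>x r R. x \<in> K \<Longrightarrow> 0 < r \<Longrightarrow> r < R \<Longrightarrow> R < diameter K \<Longrightarrow>
      measure M (ball x R) / measure M (ball x r) \<le> C * (R / r) powr s"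
    by blast
  show "t \<le> s"
  proof (rule ccontr)
    assume "\<not> t \<le> s"
    \<comment> \<open>The midpoint leaves a positive gap \<open>s' - s\<close>, and it is positive
      even for s = 0, as the lower ratio bound demands. With R fixed and \<open>R / r = u\<close>,
      the two bounds give \<open>c * u powr s' \<le> C * u powr s\<close>, which fails for large
      u.\<close>
    define s' where "s' = (s + t) / 2"
    have s': "0 < s'" "s' < t" "s < s'" using s \<open>\<not> t \<le> s\<close> t_nonneg by (auto simp: s'_def)
    obtain c where c: "c > 0" "\<And>x r R. x \<in> K \<Longrightarrow> 0 < r \<Longrightarrow> r \<le> R \<Longrightarrow> R \<le> 2 \<Longrightarrow>
        c * (R / r) powr s' * measure M (ball x r) \<le> measure M (ball x R)"
      using ratio_ge[OF s'(1,2)] by blast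
    obtain u where u: "1 < u" "C / c < u powr (s' - s)" using powr_unbounded[of "s' - s"] s' by auto
    obtain x where x: "x \<in> K" using K_nonempty by blast
    define R where "R = diameter K / 2"
    define r where "r = R / u"
    have rR: "0 < r" "r < R" "R < diameter K" "R \<le> 2" "R / r = u"
      using diameter_pos diameter_le_1 u by (auto simp: R_def r_def field_simps)
    have "c * u powr s' \<le> measure M (ball x R) / measure M (ball x r)"
      using c(2)[OF x rR(1) _ rR(4)] rR ball_pos[OF x rR(1)] by (simp add: pos_le_divide_eq)
    also have "\<dots> \<le> C * u powr s" using C(2)[OF x rR(1-3)] rR by simp
    finally have "u powr s' / u powr s \<le> C / c"
      using c(1) u by (simp add: divide_simps mult.commute)
    then show False using u by (simp add: powr_diff)
  qed
qed

lemma lower_dim_eq: "lower_dim M = ereal t"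
  unfolding lower_dim_def
proof (rule Sup_ereal_threshold[OF t_nonneg])
  \<comment> \<open>Exponent 0 is always admissible, by monotonicity of the measure; it settles the
    case t = 0.\<close>
  have "1 \<le> measure M (ball x R) / measure M (ball x r)" if "0 < r" "r < R" "x \<in> K" for r R x
    using that ball_pos[of x r] by (subst pos_le_divide_eq) (auto intro!: finite_measure_mono simp: sets_M)
  then show "0 \<le> (0::real) \<and> (\<exists>C>0. \<forall>r R. 0 < r \<and> r < R \<and> R < diameter K \<longrightarrow>
      (\<forall>x\<in>K. C * (R / r) powr 0 \<le> measure M (ball x R) / measure M (ball x r)))"
    by (auto intro!: exI[of _ 1])
next
  fix s :: real assume s: "0 < s" "s < t"
  then obtain C where C: "C > 0" "\<And>x r R. x \<in> K \<Longrightarrow> 0 < r \<Longrightarrow> r \<le> R \<Longrightarrow> R \<le> 2 \<Longrightarrow>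
      C * (R / r) powr s * measure M (ball x r) \<le> measure M (ball x R)"
    using ratio_ge[of s] by blast
  have "C * (R / r) powr s \<le> measure M (ball x R) / measure M (ball x r)"
    if "0 < r" "r < R" "R < diameter K" "x \<in> K" for r R x
    using C(2)[of x r R] that ball_pos[of x r] diameter_le_1 by (simp add: pos_le_divide_eq)
  then show "0 \<le> s \<and> (\<exists>C>0. \<forall>r R. 0 < r \<and> r < R \<and> R < diameter K \<longrightarrow>
      (\<forall>x\<in>K. C * (R / r) powr s \<le> measure M (ball x R) / measure M (ball x r)))"
    using C(1) s by (intro conjI exI[of _ C]) auto
next
  fix s assume s: "0 \<le> s \<and> (\<exists>C>0. \<forall>r R. 0 < r \<and> r < R \<and> R < diameter K \<longrightarrow>
      (\<forall>x\<in>K. C * (R / r) powr s \<le> measure M (ball x R) / measure M (ball x r)))"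
  then obtain C where C: "C > 0" "\<And>x r R. x \<in> K \<Longrightarrow> 0 < r \<Longrightarrow> r < R \<Longrightarrow> R < diameter K \<Longrightarrow>
      C * (R / r) powr s \<le> measure M (ball x R) / measure M (ball x r)"
    by blast
  show "s \<le> t"
  proof (rule ccontr)
    assume "\<not> s \<le> t"
    define s' where "s' = (s + t) / 2"
    have s': "t < s'" "s' < s" using \<open>\<not> s \<le> t\<close> by (auto simp: s'_def)
    obtain c where c: "c > 0" "\<And>x r R. x \<in> K \<Longrightarrow> 0 < r \<Longrightarrow> r \<le> R \<Longrightarrow> R \<le> 2 \<Longrightarrow>
        measure M (ball x R) \<le> c * (R / r) powr s' * measure M (ball x r)"
      using ratio_le[OF s'(1)] by blast
    obtain u where u: "1 < u" "c / C < u powr (s - s')" using powr_unbounded[of "s - s'"] s' by auto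
    obtain x where x: "x \<in> K" using K_nonempty by blast
    define R where "R = diameter K / 2"
    define r where "r = R / u"
    have rR: "0 < r" "r < R" "R < diameter K" "R \<le> 2" "R / r = u"
      using diameter_pos diameter_le_1 u by (auto simp: R_def r_def field_simps)
    have "C * u powr s \<le> measure M (ball x R) / measure M (ball x r)"
      using C(2)[OF x rR(1-3)] rR by simp
    also have "\<dots> \<le> c * u powr s'"
      using c(2)[OF x rR(1) _ rR(4)] rR ball_pos[OF x rR(1)] by (simp add: pos_divide_le_eq)
    finally have "u powr s / u powr s' \<le> c / C"
      using C(1) u by (simp add: divide_simps mult.commute)
    then show False using u by (simp add: powr_diff)
  qed
qed

section \<open>Mass distribution principle for Hausdorff measure\<close>

lemma outer_measure_le_diameter_power:
  assumes "0 \<le> s" "s < t"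
  shows "\<exists>C>0. \<forall>U. bounded U \<and> diameter U \<le> 1 \<longrightarrow>
    outer_measure_of M (U \<inter> K) \<le> ennreal C * diameter_power s U"
proof -
  obtain C where C: "C \<ge> 1" "\<And>x r. x \<in> K \<Longrightarrow> 0 < r \<Longrightarrow> r \<le> 2 \<Longrightarrow> measure M (ball x r) \<le> C * r powr s"
    using ball_le[OF assms] by blast
  have outer: "outer_measure_of M (U \<inter> K) \<le> measure M (ball x r)" if "U \<subseteq> ball x r" for U x r
  proof -
    have "outer_measure_of M (U \<inter> K) \<le> outer_measure_of M (ball x r)"
      using that by (intro outer_measure_of_mono) auto
    then show ?thesis by (simp add: sets_M emeasure_eq_measure)
  qed
  \<comment> \<open>A set U meeting K at x lies in the closed ball of radius
    \<open>diameter U\<close> about x. Doubling the radius gives an open ball, still of radius at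
    most 2. The exponent 0 and diameter 0 need separate care.\<close>
  have "outer_measure_of M (U \<inter> K) \<le> ennreal (C * 2 powr s) * diameter_power s U"
    if U: "bounded U" "diameter U \<le> 1" for U
  proof (cases "U \<inter> K = {}")
    case True
    then show ?thesis by simp
  next
    case False
    then obtain x where x: "x \<in> U" "x \<in> K" by auto
    have sub: "U \<subseteq> cball x (diameter U)"
      using diameter_bounded_bound[OF U(1) x(1)] by auto
    show ?thesis
    proof (cases "s = 0")
      case True
      have "cball x (diameter U) \<subseteq> ball x 2" using U(2) by auto
      then have "U \<subseteq> ball x 2" using sub by (rule order_trans[rotated])
      then have "outer_measure_of M (U \<inter> K) \<le> 1"
        using outer[of U x 2] by (meson ennreal_le_1 order_trans prob_le_1)
      also have "1 \<le> ennreal (C * 2 powr s) * diameter_power s U"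
        using C(1) True x by (auto simp: diameter_power_def)
      finally show ?thesis .
    next
      case s: False
      show ?thesis
      proof (cases "diameter U = 0")
        \<comment> \<open>Here \<open>diameter_power\<close> is 0, so the set must be null: balls
          about x have arbitrarily small mass because s is positive.\<close>
        case True
        have "outer_measure_of M (U \<inter> K) \<le> ennreal e" if e: "e > 0" for e :: real
        proof -
          obtain d where d: "d > 0" "d \<le> 1" "d powr s < e / C"
            using powr_small[of s "e / C"] assms s e C(1) by (auto simp: zero_less_divide_iff)
          have "outer_measure_of M (U \<inter> K) \<le> measure M (ball x d)"
          proof (intro outer order_trans[OF sub])
            show "cball x (diameter U) \<subseteq> ball x d" using True d by simp
          qed
          also have "measure M (ball x d) \<le> e"
            using C(2)[OF x(2), of d] d C(1) by (simp add: field_simps)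
          finally show ?thesis by (simp add: ennreal_leI)
        qed
        then have "outer_measure_of M (U \<inter> K) = 0"
          by (rule ennreal_eq_0I)
        then show ?thesis by simp
      next
        case False
        define d where "d = diameter U"
        have d: "0 < d" "d \<le> 1" using False U diameter_ge_0[OF U(1)] by (auto simp: d_def)
        have "outer_measure_of M (U \<inter> K) \<le> measure M (ball x (2 * d))"
        proof (intro outer order_trans[OF sub])
          show "cball x (diameter U) \<subseteq> ball x (2 * d)" using d by (simp add: d_def cball_subset_ball_iff)
        qed
        also have "\<dots> \<le> ennreal (C * (2 * d) powr s)"
          using C(2)[OF x(2), of "2 * d"] d by (intro ennreal_leI) auto
        also have "\<dots> = ennreal (C * 2 powr s) * diameter_power s U"
          using s x d C(1) by (auto simp: diameter_power_def powr_mult d_def ennreal_mult[symmetric] mult.assoc)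
        finally show ?thesis .
      qed
    qed
  qed
  then show ?thesis using C(1) by (intro exI[of _ "C * 2 powr s"]) auto
qed

text \<open>The covers in both fractal measures consist of arbitrary sets, so subadditivity is
  applied to measurable hulls with the same outer measure.\<close>

lemma emeasure_le_suminf_outer:
  assumes "E \<in> sets M" "E \<subseteq> (\<Union>i::nat. A i)"
  shows "emeasure M E \<le> (\<Sum>i. outer_measure_of M (A i \<inter> K))"
proof -
  obtain V where V: "\<And>i. V i \<in> sets M" "\<And>i. A i \<inter> K \<subseteq> V i"
      "\<And>i. outer_measure_of M (A i \<inter> K) = emeasure M (V i)"
  proof -
    have "\<forall>i. \<exists>V. V \<in> sets M \<and> A i \<inter> K \<subseteq> V \<and> outer_measure_of M (A i \<inter> K) = emeasure M V"
    proof
      fix i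
      show "\<exists>V. V \<in> sets M \<and> A i \<inter> K \<subseteq> V \<and> outer_measure_of M (A i \<inter> K) = emeasure M V"
        using outer_measure_of_attain[of "A i \<inter> K" M] by auto
    qed
    from choice[OF this] show ?thesis using that by auto
  qed
  have "emeasure M E = emeasure M (E \<inter> K)" using assms(1) by (simp add: emeasure_Int_K)
  also have "\<dots> \<le> emeasure M (\<Union>i. V i)"
  proof (rule emeasure_mono)
    show "E \<inter> K \<subseteq> (\<Union>i. V i)"
    proof
      fix x assume x: "x \<in> E \<inter> K"
      then obtain i where "x \<in> A i" using assms(2) by auto
      then have "x \<in> V i" using V(2)[of i] x by auto
      then show "x \<in> (\<Union>i. V i)" by auto
    qed
    show "(\<Union>i. V i) \<in> sets M" using V(1) by (intro sets.countable_UN) auto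
  qed
  also have "\<dots> \<le> (\<Sum>i. emeasure M (V i))"
    using V by (intro emeasure_subadditive_countably) auto
  finally show ?thesis by (simp add: V(3))
qed

text \<open>If s < t, each covering set carries mass at most C times its diameter power. A cover of
  E with small total then contradicts the positive mass of E; covers by sets of diameter at most 1
  suffice.\<close>

lemma hausdorff_dim_ge:
  assumes "E \<in> sets borel" "emeasure M E > 0" "0 \<le> s" "hausdorff_measure s E = 0"
  shows "t \<le> s"
proof (rule ccontr)
  assume "\<not> t \<le> s"
  then obtain C where C: "C > 0" "\<And>U. bounded U \<Longrightarrow> diameter U \<le> 1 \<Longrightarrow>
      outer_measure_of M (U \<inter> K) \<le> ennreal C * diameter_power s U"
    using outer_measure_le_diameter_power[of s] assms by auto
  have "hausdorff_premeasure s 1 E \<le> hausdorff_measure s E"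
    unfolding hausdorff_measure_def by (intro SUP_upper) auto
  then have "hausdorff_premeasure s 1 E < emeasure M E / ennreal C"
    using assms(2,4) C(1) by (auto simp: ennreal_zero_less_divide)
  then obtain U where U: "E \<subseteq> (\<Union>i. U i)" "\<And>i. bounded (U i)" "\<And>i. diameter (U i) \<le> 1"
      "(\<Sum>i. diameter_power s (U i)) < emeasure M E / ennreal C"
    unfolding hausdorff_premeasure_def INF_less_iff by auto
  have "emeasure M E \<le> (\<Sum>i. outer_measure_of M (U i \<inter> K))"
    using assms(1) U(1) by (intro emeasure_le_suminf_outer) (auto simp: sets_M)
  also have "\<dots> \<le> (\<Sum>i. ennreal C * diameter_power s (U i))"
    using U C by (intro suminf_le) auto
  also have "\<dots> = ennreal C * (\<Sum>i. diameter_power s (U i))" by simp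
  also have "\<dots> < ennreal C * (emeasure M E / ennreal C)"
    using C U(4) by (intro ennreal_mult_strict_left_mono) auto
  also have "\<dots> = emeasure M E"
    using C(1) by (rule ennreal_mult_divide_cancel)
  finally show False by simp
qed

section \<open>Nets, packings and the packing measure\<close>

lemma separated_net:
  assumes "A \<subseteq> K" "0 < d"
  obtains N where "finite N" "N \<subseteq> A" "disjoint_family_on (\<lambda>x. cball x d) N" "A \<subseteq> (\<Union>x\<in>N. cball x (2 * d))"
proof -
  define s :: real where "s = t + 1"
  obtain c where c: "c > 0" "\<And>x r. x \<in> K \<Longrightarrow> 0 < r \<Longrightarrow> r \<le> 2 \<Longrightarrow> c * r powr s \<le> measure M (ball x r)"
    using ball_ge[of s] by (auto simp: s_def)
  \<comment> \<open>A lower bound for the mass of every d-ball centred in K, hence at most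
    \<open>1 / m\<close> of them are disjoint. The minimum respects the range r \<le> 2 of
    \<open>ball_ge\<close>; any exponent above t would do for s.\<close>
  define m where "m = c * (min d 2) powr s"
  have m: "0 < m" using c assms by (simp add: m_def)
  let ?P = "\<lambda>N. finite N \<and> N \<subseteq> A \<and> disjoint_family_on (\<lambda>x. cball x d) N"
  have card: "real (card N) \<le> 1 / m" if "?P N" for N
  proof -
    have "m * card N = (\<Sum>x\<in>N. m)" by simp
    also have "\<dots> \<le> (\<Sum>x\<in>N. measure M (cball x d))"
    proof (intro sum_mono)
      fix x assume "x \<in> N"
      then have "m \<le> measure M (ball x (min d 2))"
        using that assms by (auto simp: m_def intro!: c)
      also have "\<dots> \<le> measure M (cball x d)" by (intro finite_measure_mono) (auto simp: sets_M)
      finally show "m \<le> measure M (cball x d)" .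
    qed
    also have "\<dots> = measure M (\<Union>x\<in>N. cball x d)"
      using that by (intro finite_measure_finite_Union[symmetric]) (auto simp: sets_M)
    also have "\<dots> \<le> 1" by simp
    finally show ?thesis using m by (simp add: field_simps)
  qed
  have "card N < Suc (nat \<lceil>1 / m\<rceil>)" if "?P N" for N
    using card[OF that] by linarith
  then obtain N where N: "?P N" "\<And>N'. ?P N' \<Longrightarrow> card N' \<le> card N"
    using ex_has_greatest_nat[of ?P "{}" card "Suc (nat \<lceil>1 / m\<rceil>)"] by (auto simp: disjoint_family_on_def)
  \<comment> \<open>A point farther than 2d from every centre could be added to N, against its
    maximal cardinality.\<close>
  have "A \<subseteq> (\<Union>x\<in>N. cball x (2 * d))"
  proof
    fix y assume y: "y \<in> A"
    show "y \<in> (\<Union>x\<in>N. cball x (2 * d))"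
    proof (rule ccontr)
      assume "y \<notin> (\<Union>x\<in>N. cball x (2 * d))"
      then have far: "dist x y > 2 * d" if "x \<in> N" for x using that by force
      then have "y \<notin> N" using assms(2) by force
      have disj: "cball x d \<inter> cball y d = {}" if "x \<in> N" for x
        using far[OF that] by (intro disjoint_cballI) simp
      have "disjoint_family_on (\<lambda>x. cball x d) (insert y N)"
        using N(1) disj \<open>y \<notin> N\<close> unfolding disjoint_family_on_def by (auto simp: Int_commute simp del: Int_iff)
      then have "?P (insert y N)" using N(1) y by auto
      from N(2)[OF this] N(1) \<open>y \<notin> N\<close> show False by simp
    qed
  qed
  with N(1) show ?thesis using that by blast
qed

lemma uniform_packing:
  assumes "finite N" "N \<subseteq> A" "disjoint_family_on (\<lambda>x. cball x d) N" "0 < d" "d \<le> \<delta>"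
  shows "ennreal (card N * (2 * d) powr s) \<le> packing_content s \<delta> A"
proof -
  let ?P = "(\<lambda>x. (x, d)) ` N"
  have "?P \<in> packings \<delta> A"
    using assms by (auto simp: packings_def disjoint_family_on_def countable_finite)
  then have "(\<Sum>\<^sub>\<infinity>(x, r)\<in>?P. ennreal ((2 * r) powr s)) \<le> packing_content s \<delta> A"
    unfolding packing_content_def by (rule SUP_upper)
  moreover have "(\<Sum>\<^sub>\<infinity>(x, r)\<in>?P. ennreal ((2 * r) powr s)) = (\<Sum>x\<in>N. ennreal ((2 * d) powr s))"
    using assms by (subst infsum_finite) (auto simp: sum.reindex inj_on_def)
  ultimately show ?thesis by (simp add: ennreal_mult ennreal_of_nat_eq_real_of_nat)
qed

text \<open>In \<open>r powr s = r powr (s - s') * r powr s'\<close> the first factor is at most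
  \<open>\<delta> powr (s - s')\<close>, and the second is at most the mass of the ball divided by
  c. Disjointness bounds the sum of the masses by 1.\<close>

lemma packing_content_le:
  assumes "t < s'" "s' < s"
  shows "\<exists>C>0. \<forall>\<delta>. 0 < \<delta> \<and> \<delta> \<le> 1 \<longrightarrow> packing_content s \<delta> K \<le> ennreal (C * \<delta> powr (s - s'))"
proof -
  obtain c where c: "c > 0" "\<And>x r. x \<in> K \<Longrightarrow> 0 < r \<Longrightarrow> r \<le> 2 \<Longrightarrow> c * r powr s' \<le> measure M (ball x r)"
    using ball_ge[OF assms(1)] by blast
  have "packing_content s \<delta> K \<le> ennreal (2 powr s / c * \<delta> powr (s - s'))" if d: "0 < \<delta>" "\<delta> \<le> 1" for \<delta>
    unfolding packing_content_def
  proof (rule SUP_least)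
    fix P assume P: "P \<in> packings \<delta> K"
    have "(\<Sum>(x, r)\<in>F. ennreal ((2 * r) powr s)) \<le> ennreal (2 powr s / c * \<delta> powr (s - s'))"
      if F: "finite F" "F \<subseteq> P" for F
    proof -
      have Fp: "x \<in> K" "0 < r" "r \<le> \<delta>" if "(x, r) \<in> F" for x r
        using P F that by (auto simp: packings_def)
      have disj: "disjoint_family_on (\<lambda>(x, r). cball x r) F"
        using P F by (auto simp: packings_def intro: disjoint_family_on_mono)
      have "(\<Sum>(x, r)\<in>F. (2 * r) powr s) \<le> (\<Sum>p\<in>F. 2 powr s / c * \<delta> powr (s - s') * measure M (case p of (x, r) \<Rightarrow> cball x r))"
      proof (intro sum_mono, clarify)
        fix x r assume xr: "(x, r) \<in> F"
        have "(2 * r) powr s = 2 powr s * (r powr (s - s') * r powr s')"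
          using Fp[OF xr] by (simp add: powr_mult powr_add[symmetric])
        also have "\<dots> \<le> 2 powr s * (\<delta> powr (s - s') * (measure M (cball x r) / c))"
        proof (intro mult_left_mono mult_mono)
          show "r powr (s - s') \<le> \<delta> powr (s - s')" using Fp[OF xr] assms by (intro powr_mono2) auto
          have "c * r powr s' \<le> measure M (ball x r)" using Fp[OF xr] d by (intro c) auto
          also have "\<dots> \<le> measure M (cball x r)" by (intro finite_measure_mono) (auto simp: sets_M)
          finally show "r powr s' \<le> measure M (cball x r) / c" using c by (simp add: field_simps)
        qed auto
        finally show "(2 * r) powr s \<le> 2 powr s / c * \<delta> powr (s - s') * measure M (cball x r)"
          by (simp add: field_simps)
      qed
      also have "\<dots> = 2 powr s / c * \<delta> powr (s - s') * (\<Sum>p\<in>F. measure M (case p of (x, r) \<Rightarrow> cball x r))"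
        by (simp add: sum_distrib_left)
      also have "(\<Sum>p\<in>F. measure M (case p of (x, r) \<Rightarrow> cball x r)) = measure M (\<Union>p\<in>F. case p of (x, r) \<Rightarrow> cball x r)"
        using F disj by (intro finite_measure_finite_Union[symmetric]) (auto simp: sets_M)
      also have "2 powr s / c * \<delta> powr (s - s') * \<dots> \<le> 2 powr s / c * \<delta> powr (s - s') * 1"
        using c by (intro mult_left_mono) auto
      finally have "(\<Sum>(x, r)\<in>F. (2 * r) powr s) \<le> 2 powr s / c * \<delta> powr (s - s')" by simp
      moreover have "(\<Sum>(x, r)\<in>F. ennreal ((2 * r) powr s)) = ennreal (\<Sum>(x, r)\<in>F. (2 * r) powr s)"
        by (subst sum_ennreal[symmetric]) (auto simp: case_prod_beta)
      ultimately show ?thesis by (simp add: ennreal_leI)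
    qed
    then show "(\<Sum>\<^sub>\<infinity>(x, r)\<in>P. ennreal ((2 * r) powr s)) \<le> ennreal (2 powr s / c * \<delta> powr (s - s'))"
      by (subst nonneg_infsum_complete) (auto intro!: SUP_least)
  qed
  then show ?thesis using c by (intro exI[of _ "2 powr s / c"]) auto
qed

lemma packing_content_tendsto_0:
  assumes "t < s" "0 < e" "0 < \<delta>'"
  shows "\<exists>\<delta>>0. \<delta> \<le> 1 \<and> \<delta> \<le> \<delta>' \<and> packing_content s \<delta> K \<le> ennreal e"
proof -
  define s' where "s' = (s + t) / 2"
  have s': "t < s'" "s' < s" using assms by (auto simp: s'_def)
  obtain C where C: "C > 0" "\<And>\<delta>. 0 < \<delta> \<Longrightarrow> \<delta> \<le> 1 \<Longrightarrow> packing_content s \<delta> K \<le> ennreal (C * \<delta> powr (s - s'))"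
    using packing_content_le[OF s'] by blast
  obtain d where d: "0 < d" "d \<le> 1" "d powr (s - s') < e / C"
    using powr_small[of "s - s'" "e / C"] s' assms C by auto
  define \<delta> where "\<delta> = min d \<delta>'"
  have "0 < \<delta>" "\<delta> \<le> 1" "\<delta> \<le> \<delta>'" using d assms by (auto simp: \<delta>_def)
  moreover have "C * \<delta> powr (s - s') \<le> e"
  proof -
    have "\<delta> powr (s - s') \<le> d powr (s - s')"
      using s' assms d by (intro powr_mono2) (auto simp: \<delta>_def)
    then have "C * \<delta> powr (s - s') \<le> C * d powr (s - s')" using C(1) by simp
    also have "\<dots> \<le> e" using d(3) C(1) by (simp add: field_simps)
    finally show ?thesis .
  qed
  ultimately show ?thesis using C(2)[of \<delta>] by (intro exI[of _ \<delta>]) (auto intro: order_trans ennreal_leI)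
qed

lemma packing_measure_K:
  assumes "t < s"
  shows "packing_measure s K = 0"
proof -
  have "packing_premeasure s K \<le> ennreal e" if e: "0 < e" for e :: real
  proof -
    obtain \<delta> where "\<delta> > 0" "packing_content s \<delta> K \<le> ennreal e"
      using packing_content_tendsto_0[OF assms e, of 1] by auto
    then show ?thesis unfolding packing_premeasure_def by (auto intro: INF_lower2)
  qed
  then have "packing_premeasure s K = 0" by (rule ennreal_eq_0I)
  moreover have "packing_premeasure s ({} :: real set) = 0"
  proof -
    have "packings \<delta> ({} :: real set) = {{}}" for \<delta> :: real by (auto simp: packings_def disjoint_family_on_def)
    then show ?thesis by (simp add: packing_premeasure_def packing_content_def)
  qed
  moreover define A where "A = (\<lambda>i::nat. if i = 0 then K else {})"
  ultimately have "packing_premeasure s (A i) = 0" for i by (simp add: A_def)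
  then have "(\<Sum>i. packing_premeasure s (A i)) = 0" by simp
  moreover have "packing_measure s K \<le> (\<Sum>i. packing_premeasure s (A i))"
    unfolding packing_measure_def by (intro INF_lower) (auto simp: A_def intro!: exI[of _ 0])
  ultimately show ?thesis by simp
qed

text \<open>Small packing content forces small covers: a maximal family of disjoint d-balls is a
  packing, and the concentric balls of radius 2d, of diameter 4d, cover K. This costs only the
  factor \<open>2 powr s\<close>.\<close>

lemma hausdorff_measure_K:
  assumes "t < s"
  shows "hausdorff_measure s K = 0"
proof -
  have s: "0 < s" using assms t_nonneg by simp
  have *: "hausdorff_premeasure s \<delta> K \<le> ennreal e" if e: "0 < e" "0 < \<delta>" for e \<delta> :: real
  proof -
    obtain d where d: "0 < d" "d \<le> \<delta> / 4" "packing_content s d K \<le> ennreal (e / 2 powr s)"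
      using packing_content_tendsto_0[OF assms, of "e / 2 powr s" "\<delta> / 4"] e by auto
    obtain N where N: "finite N" "N \<subseteq> K" "disjoint_family_on (\<lambda>x. cball x d) N" "K \<subseteq> (\<Union>x\<in>N. cball x (2 * d))"
      using separated_net[OF subset_refl d(1)] by blast
    have "ennreal (card N * (2 * d) powr s) \<le> ennreal (e / 2 powr s)"
      using uniform_packing[OF N(1-3) d(1) order_refl] d(3) by (rule order_trans)
    then have le: "card N * (2 * d) powr s \<le> e / 2 powr s" using that by simp
    obtain g where g: "bij_betw g {0..<card N} N" using ex_bij_betw_nat_finite[OF N(1)] by blast
    define U where "U = (\<lambda>i. if i < card N then cball (g i) (2 * d) else {})"
    have diam: "diameter (cball x (2 * d)) = 4 * d" for x :: real using d by simp
    have "K \<subseteq> (\<Union>i. U i)"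
    proof
      fix x assume "x \<in> K"
      then obtain y where y: "y \<in> N" "x \<in> cball y (2 * d)" using N by blast
      then obtain i where "i < card N" "y = g i" using g unfolding bij_betw_def by force
      with y show "x \<in> (\<Union>i. U i)" by (auto simp: U_def intro!: exI[of _ i])
    qed
    moreover have "bounded (U i) \<and> diameter (U i) \<le> \<delta>" for i
      using d that diam by (auto simp: U_def)
    ultimately have "hausdorff_premeasure s \<delta> K \<le> (\<Sum>i. diameter_power s (U i))"
      unfolding hausdorff_premeasure_def by (intro INF_lower) auto
    also have "\<dots> = (\<Sum>i<card N. diameter_power s (U i))"
      by (intro suminf_finite) (auto simp: U_def diameter_power_def)
    also have "\<dots> = (\<Sum>i<card N. ennreal ((4 * d) powr s))"
      using s d by (intro sum.cong) (auto simp: U_def diameter_power_def)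
    also have "\<dots> = ennreal (card N * (4 * d) powr s)"
      by (simp add: ennreal_mult ennreal_of_nat_eq_real_of_nat)
    also have "(4 * d) powr s = 2 powr s * (2 * d) powr s"
      using d by (simp add: powr_mult[symmetric])
    also have "ennreal (card N * (2 powr s * (2 * d) powr s)) \<le> ennreal e"
      using le by (intro ennreal_leI) (simp add: field_simps)
    finally show ?thesis .
  qed
  have "hausdorff_premeasure s \<delta> K = 0" if "0 < \<delta>" for \<delta>
    by (rule ennreal_eq_0I) (use *[OF _ that] in auto)
  then show ?thesis unfolding hausdorff_measure_def by (intro antisym SUP_least) auto
qed

text \<open>The packing analogue of the mass distribution principle. A separated net of
  \<open>A \<inter> K\<close> is at once a packing of A with balls of radius d and, after doubling
  the radii, a cover by sets whose mass the Frostman bound controls. The estimate is uniform in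
  \<delta> and so survives the infimum.\<close>

lemma outer_measure_le_packing_premeasure:
  assumes "0 \<le> s" "s < t"
  shows "\<exists>C>0. \<forall>A. outer_measure_of M (A \<inter> K) \<le> ennreal C * packing_premeasure s A"
proof -
  obtain C where C: "C \<ge> 1" "\<And>x r. x \<in> K \<Longrightarrow> 0 < r \<Longrightarrow> r \<le> 2 \<Longrightarrow> measure M (ball x r) \<le> C * r powr s"
    using ball_le[OF assms] by blast
  define C' where "C' = C * 2 powr s"
  have C': "0 < C'" using C by (simp add: C'_def)
  have content: "outer_measure_of M (A \<inter> K) / ennreal C' \<le> packing_content s \<delta> A" if "0 < \<delta>" for A \<delta>
  proof -
    \<comment> \<open>At most 1/2, so that the balls of radius 4d used below stay within the range r
      \<le> 2 of the Frostman bound.\<close>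
    define d where "d = min \<delta> (1 / 2)"
    have d: "0 < d" "d \<le> \<delta>" "d \<le> 1 / 2" using that by (auto simp: d_def)
    obtain N where N: "finite N" "N \<subseteq> A \<inter> K" "disjoint_family_on (\<lambda>x. cball x d) N"
        "A \<inter> K \<subseteq> (\<Union>x\<in>N. cball x (2 * d))"
      using separated_net[OF _ d(1), of "A \<inter> K"] by blast
    have "outer_measure_of M (A \<inter> K) \<le> outer_measure_of M (\<Union>x\<in>N. cball x (2 * d))"
      by (intro outer_measure_of_mono N)
    also have "\<dots> = ennreal (measure M (\<Union>x\<in>N. cball x (2 * d)))"
      using N by (subst outer_measure_of_eq) (auto simp: sets_M emeasure_eq_measure)
    also have "measure M (\<Union>x\<in>N. cball x (2 * d)) \<le> (\<Sum>x\<in>N. measure M (cball x (2 * d)))"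
      using N by (intro finite_measure_subadditive_finite) (auto simp: sets_M)
    also have "\<dots> \<le> (\<Sum>x\<in>N. C' * (2 * d) powr s)"
    proof (intro sum_mono)
      fix x assume "x \<in> N"
      have "measure M (cball x (2 * d)) \<le> measure M (ball x (4 * d))"
        using d by (intro finite_measure_mono) (auto simp: sets_M)
      also have "\<dots> \<le> C * (4 * d) powr s" using \<open>x \<in> N\<close> N d by (intro C) auto
      also have "(4 * d) powr s = 2 powr s * (2 * d) powr s"
        using d by (simp add: powr_mult[symmetric])
      finally show "measure M (cball x (2 * d)) \<le> C' * (2 * d) powr s"
        by (simp add: C'_def)
    qed
    also have "\<dots> = C' * (card N * (2 * d) powr s)" by simp
    finally have "outer_measure_of M (A \<inter> K) \<le> ennreal C' * ennreal (card N * (2 * d) powr s)"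
      using C' by (simp add: ennreal_leI ennreal_mult[symmetric])
    also have "\<dots> \<le> ennreal C' * packing_content s \<delta> A"
      using N d by (intro mult_left_mono uniform_packing) auto
    finally show ?thesis using C' by (simp add: divide_le_posI_ennreal mult.commute)
  qed
  have "outer_measure_of M (A \<inter> K) \<le> ennreal C' * packing_premeasure s A" for A
  proof -
    have "outer_measure_of M (A \<inter> K) / ennreal C' \<le> packing_premeasure s A"
      unfolding packing_premeasure_def using content by (intro INF_greatest) auto
    then have "ennreal C' * (outer_measure_of M (A \<inter> K) / ennreal C') \<le> ennreal C' * packing_premeasure s A"
      by (rule mult_left_mono) simp
    then show ?thesis using C' by (simp only: ennreal_mult_divide_cancel)
  qed
  then show ?thesis using C' by blast
qed

lemma packing_dim_ge:
  assumes "E \<in> sets borel" "emeasure M E > 0" "0 \<le> s" "packing_measure s E = 0"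
  shows "t \<le> s"
proof (rule ccontr)
  assume "\<not> t \<le> s"
  then obtain C where C: "C > 0" "\<And>A. outer_measure_of M (A \<inter> K) \<le> ennreal C * packing_premeasure s A"
    using outer_measure_le_packing_premeasure[of s] assms by auto
  have "packing_measure s E < emeasure M E / ennreal C"
    using assms(2,4) C(1) by (auto simp: ennreal_zero_less_divide)
  then obtain A where A: "E \<subseteq> (\<Union>i. A i)" "(\<Sum>i. packing_premeasure s (A i)) < emeasure M E / ennreal C"
    unfolding packing_measure_def INF_less_iff by auto
  have "emeasure M E \<le> (\<Sum>i. outer_measure_of M (A i \<inter> K))"
    using assms(1) A(1) by (intro emeasure_le_suminf_outer) (auto simp: sets_M)
  also have "\<dots> \<le> (\<Sum>i. ennreal C * packing_premeasure s (A i))"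
    using C by (intro suminf_le) auto
  also have "\<dots> = ennreal C * (\<Sum>i. packing_premeasure s (A i))" by simp
  also have "\<dots> < ennreal C * (emeasure M E / ennreal C)"
    using C A by (intro ennreal_mult_strict_left_mono) auto
  also have "\<dots> = emeasure M E"
    using C(1) by (rule ennreal_mult_divide_cancel)
  finally show False by simp
qed

text \<open>The support attains the infimum: it has full mass and dimension t, while no Borel set of
  positive mass has smaller dimension.\<close>

lemma measure_hausdorff_dim_eq: "measure_hausdorff_dim M = ereal t"
proof (rule antisym)
  have "hausdorff_dim K = ereal t"
    unfolding hausdorff_dim_def
    using hausdorff_measure_K hausdorff_dim_ge[of K] t_nonneg emeasure_K closed_measure_support[of M]
    by (intro Inf_ereal_threshold) auto
  then show "measure_hausdorff_dim M \<le> ereal t"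
    unfolding measure_hausdorff_dim_def using emeasure_K closed_measure_support[of M]
    by (intro INF_lower2[of K]) auto
  show "ereal t \<le> measure_hausdorff_dim M"
    unfolding measure_hausdorff_dim_def hausdorff_dim_def
    using hausdorff_dim_ge by (auto intro!: INF_greatest Inf_greatest)
qed

lemma measure_packing_dim_eq: "measure_packing_dim M = ereal t"
proof (rule antisym)
  have "packing_dim K = ereal t"
    unfolding packing_dim_def
    using packing_measure_K packing_dim_ge[of K] t_nonneg emeasure_K closed_measure_support[of M]
    by (intro Inf_ereal_threshold) auto
  then show "measure_packing_dim M \<le> ereal t"
    unfolding measure_packing_dim_def using emeasure_K closed_measure_support[of M]
    by (intro INF_lower2[of K]) auto
  show "ereal t \<le> measure_packing_dim M"
    unfolding measure_packing_dim_def packing_dim_def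
    using packing_dim_ge by (auto intro!: INF_greatest Inf_greatest)
qed

end

section \<open>Sets of digits with uniform density\<close>

definition digit_count :: "nat set \<Rightarrow> nat \<Rightarrow> nat" where
  "digit_count S n = card (S \<inter> {..<n})"

text \<open>The constant C may depend on e but not on the window; in the ball ratios it becomes the
  factor \<open>2 powr C\<close>.\<close>

definition uniform_density :: "nat set \<Rightarrow> real \<Rightarrow> bool" where
  "uniform_density S t \<longleftrightarrow> (\<forall>e>0. \<exists>C. \<forall>m n. m \<le> n \<longrightarrow>
     \<bar>real (digit_count S n) - real (digit_count S m) - t * (real n - real m)\<bar> \<le> e * (real n - real m) + C)"

lemma digit_count_0 [simp]: "digit_count S 0 = 0"
  by (simp add: digit_count_def)

lemma digit_count_Suc: "digit_count S (Suc n) = digit_count S n + of_bool (n \<in> S)"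
  by (auto simp: digit_count_def lessThan_Suc Int_insert_right)

lemma digit_count_finite:
  assumes "finite S"
  shows "digit_count S n \<le> card S"
  unfolding digit_count_def by (rule card_mono[OF assms]) auto

lemma digit_count_Compl: "digit_count S n + digit_count (- S) n = n"
  by (induction n) (auto simp: digit_count_Suc)

text \<open>The count of \<open>S\<close> is the integer part of the partial sums of a sequence in \<open>(0, 1)\<close> that
  converges to \<open>t\<close>, but so slowly that the sums of the sequence and of its complement to \<open>1\<close> diverge.\<close>

lemma ex_uniform_density:
  assumes t: "0 \<le> t" "t \<le> 1"
  obtains S where "infinite S" "infinite (- S)" "0 \<notin> S" "uniform_density S t"
proof -
  \<comment> \<open>This equals (t * j + 1) / (j + 2), the mean of j copies of t, one 0 and one 1.
    Hence for every t in [0, 1] it stays 1 / (j + 2) away from 0 and from 1, and differs from t by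
    at most 1 / (j + 2). The first makes both counts diverge like the harmonic series, the second
    gives the density.\<close>
  define \<tau> where "\<tau> j = t + (1 - 2 * t) / (real j + 2)" for j :: nat
  define g where "g n = (\<Sum>j<n. \<tau> j)" for n
  define f where "f n = nat \<lfloor>g n\<rfloor>" for n
  define S where "S = {k. f k < f (Suc k)}"
  have frac: "a + (1 - 2 * a) / (d + 2) - 1 / (d + 2) = a * d / (d + 2)" if "0 \<le> d" for a d :: real
    using that by (simp add: divide_simps) (simp add: algebra_simps)
  have \<tau>_ge: "1 / (real j + 2) \<le> \<tau> j" for j
  proof -
    have "\<tau> j - 1 / (real j + 2) = t * real j / (real j + 2)"
      using frac[of "real j" t] by (simp add: \<tau>_def)
    also have "\<dots> \<ge> 0" using t by simp
    finally show ?thesis by simp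
  qed
  have \<tau>_le: "1 / (real j + 2) \<le> 1 - \<tau> j" for j
  proof -
    have "1 - \<tau> j = (1 - t) + (1 - 2 * (1 - t)) / (real j + 2)"
      by (simp add: \<tau>_def divide_simps) (simp add: algebra_simps)
    then have "1 - \<tau> j - 1 / (real j + 2) = (1 - t) * real j / (real j + 2)"
      using frac[of "real j" "1 - t"] by simp
    also have "\<dots> \<ge> 0" using t by simp
    finally show ?thesis by simp
  qed
  have \<tau>01: "0 < \<tau> j" "\<tau> j < 1" for j
  proof -
    have "0 < 1 / (real j + 2)" by simp
    then show "0 < \<tau> j" "\<tau> j < 1" using \<tau>_ge[of j] \<tau>_le[of j] by linarith+
  qed
  have g_nonneg: "0 \<le> g n" for n
    unfolding g_def using \<tau>01 by (intro sum_nonneg) (simp add: less_imp_le)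
  have f_le: "real (f n) \<le> g n" "g n < real (f n) + 1" for n
    using g_nonneg[of n] unfolding f_def by linarith+
  have f_0: "f 0 = 0" by (simp add: f_def g_def)
  have f_Suc: "f (Suc n) = f n + of_bool (n \<in> S)" for n
  proof -
    have "g (Suc n) = g n + \<tau> n" by (simp add: g_def)
    then have "real (f n) < real (f (Suc n)) + 1" "real (f (Suc n)) < real (f n) + 2"
      using f_le[of n] f_le[of "Suc n"] \<tau>01[of n] by linarith+
    then have "f n \<le> f (Suc n)" "f (Suc n) \<le> f n + 1" by linarith+
    then show ?thesis by (auto simp: S_def)
  qed
  have count: "digit_count S n = f n" for n
    by (induction n) (simp_all add: f_0 f_Suc digit_count_Suc)
  have harm: "(\<Sum>j<n. 1 / (real j + 2)) = harm (Suc n) - 1" for n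
  proof (induction n)
    case 0
    show ?case by (simp add: harm_Suc harm_expand)
  next
    case (Suc n)
    then show ?case by (simp add: harm_Suc[of "Suc n"] inverse_eq_divide add.commute)
  qed
  have unbounded: "\<exists>n. c < (\<Sum>j<n. 1 / (real j + 2))" for c :: real
  proof -
    have "filterlim (\<lambda>n. harm n :: real) at_top sequentially" by (rule harm_at_top)
    then have "eventually (\<lambda>n. harm n > c + 1) sequentially" by (simp add: filterlim_at_top_dense)
    then obtain N where "\<And>n. n \<ge> N \<Longrightarrow> (harm n :: real) > c + 1"
      by (auto simp: eventually_sequentially)
    from this[of "Suc N"] show ?thesis by (intro exI[of _ N]) (simp add: harm)
  qed
  have "infinite S"
  proof
    assume fin: "finite S"
    obtain n where n: "real (card S) + 1 < (\<Sum>j<n. 1 / (real j + 2))" using unbounded by blast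
    also have "\<dots> \<le> g n" unfolding g_def by (intro sum_mono \<tau>_ge)
    also have "\<dots> < real (digit_count S n) + 1" using f_le by (simp add: count)
    finally show False using digit_count_finite[OF fin, of n] by simp
  qed
  moreover have "infinite (- S)"
  proof
    assume fin: "finite (- S)"
    \<comment> \<open>No \<open>+ 1\<close> as for S: rounding the partial sums down only enlarges
      the count of the complement.\<close>
    obtain n where n: "real (card (- S)) < (\<Sum>j<n. 1 / (real j + 2))" using unbounded by blast
    also have "\<dots> \<le> (\<Sum>j<n. 1 - \<tau> j)" by (intro sum_mono \<tau>_le)
    also have "\<dots> = real n - g n" by (simp add: g_def sum_subtractf)
    also have "\<dots> \<le> real n - real (digit_count S n)" using f_le(1)[of n] by (simp add: count)
    also have "\<dots> = real (digit_count (- S) n)" using digit_count_Compl[of S n] by linarith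
    finally show False using digit_count_finite[OF fin, of n] by simp
  qed
  moreover have "0 \<notin> S"
  proof -
    \<comment> \<open>Position 0 has to be a gap, since the first Moran digit must also satisfy
      \<open>q < b\<close>.\<close>
    have "g (Suc 0) < 1" using \<tau>01(2)[of 0] by (simp add: g_def)
    then have "real (f (Suc 0)) < 1" using f_le(1)[of "Suc 0"] by linarith
    then show ?thesis by (simp add: S_def)
  qed
  moreover have "uniform_density S t"
    unfolding uniform_density_def
  proof (intro allI impI)
    fix e :: real assume e: "0 < e"
    \<comment> \<open>From index J on, the deviation from t is at most e. Each earlier index costs
      at most 1 extra, and rounding at the two ends of the window adds less than 1, whence the
      constant J + 1.\<close>
    define J where "J = nat \<lceil>1 / e\<rceil>"
    have "\<bar>real (digit_count S n) - real (digit_count S m) - t * (real n - real m)\<bar>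
        \<le> e * (real n - real m) + (real J + 1)" if mn: "m \<le> n" for m n
    proof -
      have summand_le: "\<bar>\<tau> j - t\<bar> \<le> e + of_bool (j < J)" for j
      proof -
        have "\<bar>\<tau> j - t\<bar> = \<bar>1 - 2 * t\<bar> / (real j + 2)" by (simp add: \<tau>_def abs_divide)
        also have "\<dots> \<le> 1 / (real j + 2)" using t by (intro divide_right_mono) auto
        also have "\<dots> \<le> e + of_bool (j < J)"
        proof (cases "j < J")
          case True
          have "1 / (real j + 2) \<le> 1" by simp
          then have "1 / (real j + 2) \<le> e + 1" using e by linarith
          then show ?thesis using True by simp
        next
          case False
          then have "1 / e \<le> real j + 2" unfolding J_def by linarith
          then show ?thesis using e False by (simp add: field_simps)
        qed
        finally show ?thesis .
      qed
      have "g n = g m + (\<Sum>j\<in>{m..<n}. \<tau> j)"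
        unfolding g_def using mn by (metis sum.atLeastLessThan_concat lessThan_atLeast0 zero_le)
      then have "g n - g m - t * (real n - real m) = (\<Sum>j\<in>{m..<n}. \<tau> j - t)"
        using mn by (simp add: sum_subtractf of_nat_diff)
      also have "\<bar>\<dots>\<bar> \<le> (\<Sum>j\<in>{m..<n}. \<bar>\<tau> j - t\<bar>)" by (rule sum_abs)
      also have "\<dots> \<le> (\<Sum>j\<in>{m..<n}. e + of_bool (j < J))" by (intro sum_mono summand_le)
      also have "\<dots> = e * (real n - real m) + real (card ({m..<n} \<inter> {j. j < J}))"
        using mn by (simp add: sum.distrib of_nat_diff sum_of_bool_eq)
      also have "card ({m..<n} \<inter> {j. j < J}) \<le> card {..<J}" by (intro card_mono) auto
      finally have "\<bar>g n - g m - t * (real n - real m)\<bar> \<le> e * (real n - real m) + real J" by simp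
      then show ?thesis using f_le[of n] f_le[of m] unfolding count by linarith
    qed
    then show "\<exists>C. \<forall>m n. m \<le> n \<longrightarrow>
        \<bar>real (digit_count S n) - real (digit_count S m) - t * (real n - real m)\<bar> \<le> e * (real n - real m) + C"
      by blast
  qed
  ultimately show ?thesis by (rule that)
qed

section \<open>Random binary digits\<close>

definition coin_space :: "(nat \<Rightarrow> bool) measure" where
  "coin_space = PiM UNIV (\<lambda>_. measure_pmf (pmf_of_set UNIV))"

definition digit :: "nat set \<Rightarrow> nat \<Rightarrow> (nat \<Rightarrow> bool) \<Rightarrow> real" where
  "digit S k \<omega> = of_bool (k \<in> S \<and> \<omega> k) * (1 / 2) ^ Suc k"

definition expansion :: "nat set \<Rightarrow> (nat \<Rightarrow> bool) \<Rightarrow> real" where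
  "expansion S \<omega> = (\<Sum>k. digit S k \<omega>)"

definition digit_measure :: "nat set \<Rightarrow> real measure" where
  "digit_measure S = distr coin_space borel (expansion S)"

text \<open>The first n binary digits read as an integer. Each of its values corresponds to one
  dyadic interval at level n and, when attained, to one cylinder of coin tosses.\<close>

primrec numerator :: "nat set \<Rightarrow> (nat \<Rightarrow> bool) \<Rightarrow> nat \<Rightarrow> nat" where
  "numerator S \<omega> 0 = 0"
| "numerator S \<omega> (Suc n) = 2 * numerator S \<omega> n + of_bool (n \<in> S \<and> \<omega> n)"

interpretation coins: product_prob_space "\<lambda>_. measure_pmf (pmf_of_set (UNIV :: bool set))" "UNIV :: nat set"
  by unfold_locales

lemma prob_space_coin_space: "prob_space coin_space"
  unfolding coin_space_def by (rule coins.P.prob_space_axioms)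

interpretation coin_space: prob_space coin_space
  by (rule prob_space_coin_space)

lemma space_coin_space [simp]: "space coin_space = UNIV"
  by (simp add: coin_space_def space_PiM PiE_def)

lemma measurable_coin [measurable]: "(\<lambda>\<omega>. \<omega> k) \<in> measurable coin_space (count_space UNIV)"
proof -
  have "(\<lambda>\<omega>. \<omega> k) \<in> measurable coin_space (measure_pmf (pmf_of_set UNIV))"
    unfolding coin_space_def by (rule measurable_component_singleton) simp
  then show ?thesis by (simp cong: measurable_cong_sets)
qed

lemma measurable_digit [measurable]: "digit S k \<in> borel_measurable coin_space"
  unfolding digit_def by measurable

lemma measurable_numerator [measurable]: "(\<lambda>\<omega>. numerator S \<omega> n) \<in> measurable coin_space (count_space UNIV)"
  by (induction n) (auto simp del: of_bool_conj)

lemma measurable_expansion [measurable]: "expansion S \<in> borel_measurable coin_space"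
  unfolding expansion_def by measurable

lemma sets_expansion [simp]: "A \<in> sets borel \<Longrightarrow> {\<omega>. expansion S \<omega> \<in> A} \<in> sets coin_space"
  using measurable_sets[OF measurable_expansion, of A S] by (simp add: vimage_def)

lemma sets_numerator [simp]: "{\<omega>. numerator S \<omega> n = j} \<in> sets coin_space"
  using measurable_sets[OF measurable_numerator, of "{j}" S n] by (simp add: vimage_def)

lemma digit_bounds: "0 \<le> digit S k \<omega>" "digit S k \<omega> \<le> (1 / 2) ^ Suc k"
  by (auto simp: digit_def)

lemma half_powers_sums: "(\<lambda>k. (1 / 2 :: real) ^ Suc (k + n)) sums (1 / 2) ^ n"
  using sums_mult[OF power_half_series, of "(1 / 2) ^ n"] by (simp add: power_add mult.commute)

lemma summable_digit: "summable (\<lambda>k. digit S k \<omega>)"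
proof (rule summable_comparison_test')
  show "summable (\<lambda>k. (1 / 2 :: real) ^ Suc k)" using half_powers_sums[of 0] by (simp add: sums_iff)
  show "norm (digit S n \<omega>) \<le> (1 / 2) ^ Suc n" for n
    using digit_bounds[of S n \<omega>] by simp
qed

lemma sum_digit: "(\<Sum>k<n. digit S k \<omega>) = real (numerator S \<omega> n) / 2 ^ n"
  by (induction n) (auto simp: digit_def field_simps)

lemma expansion_bounds:
  "real (numerator S \<omega> n) / 2 ^ n \<le> expansion S \<omega>"
  "expansion S \<omega> \<le> (real (numerator S \<omega> n) + 1) / 2 ^ n"
proof -
  have split: "expansion S \<omega> = (\<Sum>k. digit S (k + n) \<omega>) + real (numerator S \<omega> n) / 2 ^ n"
    unfolding expansion_def using suminf_split_initial_segment[OF summable_digit] by (simp add: sum_digit)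
  have s: "summable (\<lambda>k. digit S (k + n) \<omega>)" using summable_digit[of S \<omega>] by (subst summable_iff_shift)
  have "0 \<le> (\<Sum>k. digit S (k + n) \<omega>)" using s digit_bounds by (intro suminf_nonneg) auto
  then show "real (numerator S \<omega> n) / 2 ^ n \<le> expansion S \<omega>" by (simp add: split)
  have "(\<Sum>k. digit S (k + n) \<omega>) \<le> (\<Sum>k. (1 / 2) ^ Suc (k + n))"
    using s digit_bounds half_powers_sums[of n] by (intro suminf_le) (auto simp: sums_iff)
  also have "\<dots> = 1 / 2 ^ n" using half_powers_sums[of n] by (simp add: sums_iff power_divide)
  finally show "expansion S \<omega> \<le> (real (numerator S \<omega> n) + 1) / 2 ^ n"
    by (simp add: split add_divide_distrib)
qed

lemma expansion_unit: "expansion S \<omega> \<in> {0..1}"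
  using expansion_bounds[of S \<omega> 0] by simp

section \<open>Cylinders and the measure of balls\<close>

lemma numerator_eq_iff: "numerator S \<omega> n = numerator S \<omega>' n \<longleftrightarrow> (\<forall>k\<in>S \<inter> {..<n}. \<omega> k = \<omega>' k)"
proof (induction n)
  case (Suc n)
  have "2 * a + of_bool p = 2 * b + of_bool q \<longleftrightarrow> a = b \<and> p = q" for a b :: nat and p q
    by (cases p; cases q) (auto, presburger+)
  then show ?case using Suc by (auto simp: less_Suc_eq simp del: of_bool_conj)
qed simp

lemma emeasure_cylinder: "emeasure coin_space {\<omega>. \<forall>k\<in>S \<inter> {..<n}. \<omega> k = \<omega>' k} = ennreal ((1 / 2) ^ digit_count S n)"
proof -
  have "emeasure coin_space {\<omega>. \<forall>k\<in>S \<inter> {..<n}. \<omega> k = \<omega>' k} =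
      emeasure coin_space {\<omega> \<in> space coin_space. \<forall>k\<in>S \<inter> {..<n}. \<omega> k \<in> {\<omega>' k}}" by simp
  also have "\<dots> = (\<Prod>k\<in>S \<inter> {..<n}. emeasure (measure_pmf (pmf_of_set UNIV)) {\<omega>' k})"
    unfolding coin_space_def by (rule coins.emeasure_PiM_Collect) auto
  also have "\<dots> = (\<Prod>k\<in>S \<inter> {..<n}. ennreal (1 / 2))"
    by (simp add: emeasure_pmf_single)
  also have "\<dots> = ennreal ((1 / 2) ^ digit_count S n)"
    unfolding prod_constant digit_count_def by (rule ennreal_power) simp
  finally show ?thesis .
qed

lemma measure_cylinder: "measure coin_space {\<omega>. \<forall>k\<in>S \<inter> {..<n}. \<omega> k = \<omega>' k} = (1 / 2) ^ digit_count S n"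
  by (simp add: measure_def emeasure_cylinder)

lemma measure_numerator_le: "measure coin_space {\<omega>. numerator S \<omega> n = j} \<le> (1 / 2) ^ digit_count S n"
proof (cases "\<exists>\<omega>'. numerator S \<omega>' n = j")
  case True
  then obtain \<omega>' where "numerator S \<omega>' n = j" by blast
  then have "{\<omega>. numerator S \<omega> n = j} = {\<omega>. \<forall>k\<in>S \<inter> {..<n}. \<omega> k = \<omega>' k}"
    using numerator_eq_iff[of S _ n \<omega>'] by auto
  then show ?thesis by (simp add: measure_cylinder)
qed simp

lemma sets_digit_measure [simp, measurable_cong]: "sets (digit_measure S) = sets borel"
  by (simp add: digit_measure_def)

lemma real_distribution_digit_measure: "real_distribution (digit_measure S)"
  unfolding digit_measure_def by (rule coin_space.real_distribution_distr) measurable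

lemma measure_digit_measure:
  "A \<in> sets borel \<Longrightarrow> measure (digit_measure S) A = measure coin_space {\<omega>. expansion S \<omega> \<in> A}"
  unfolding digit_measure_def by (subst measure_distr) (auto simp: vimage_def)

lemma measure_ball_ge:
  assumes "(1 / 2) ^ n < r"
  shows "(1 / 2) ^ digit_count S n \<le> measure (digit_measure S) (ball (expansion S \<omega>') r)"
proof -
  have "expansion S \<omega> \<in> ball (expansion S \<omega>') r" if "\<forall>k\<in>S \<inter> {..<n}. \<omega> k = \<omega>' k" for \<omega>
  proof -
    have "numerator S \<omega> n = numerator S \<omega>' n" using that by (simp add: numerator_eq_iff)
    then have "\<bar>expansion S \<omega>' - expansion S \<omega>\<bar> \<le> 1 / 2 ^ n"
      using expansion_bounds[of S \<omega> n] expansion_bounds[of S \<omega>' n] by (simp add: add_divide_distrib abs_le_iff)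
    then show ?thesis using assms by (simp add: dist_real_def power_divide)
  qed
  then have "measure coin_space {\<omega>. \<forall>k\<in>S \<inter> {..<n}. \<omega> k = \<omega>' k} \<le>
      measure coin_space {\<omega>. expansion S \<omega> \<in> ball (expansion S \<omega>') r}"
    by (intro coin_space.finite_measure_mono sets_expansion) auto
  then show ?thesis by (simp add: measure_cylinder measure_digit_measure)
qed

lemma measure_ball_le:
  assumes "r \<le> 2 * (1 / 2) ^ n"
  shows "measure (digit_measure S) (ball x r) \<le> 5 * (1 / 2) ^ digit_count S n"
proof -
  \<comment> \<open>The numerator N satisfies \<open>N \<le> 2 ^ n * X \<le> N + 1\<close> for the
    value X of the expansion, and \<open>2 ^ n * X\<close> is within 2 of \<open>2 ^ n * x\<close>.
    So N lies strictly between a and a + 5, which leaves at most five integers.\<close>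
  define a where "a = 2 ^ n * x - 3"
  define J where "J = nat ` {\<lfloor>a\<rfloor> + 1..\<lfloor>a\<rfloor> + 5}"
  have J: "finite J" "card J \<le> 5"
    using card_image_le[of "{\<lfloor>a\<rfloor> + 1..\<lfloor>a\<rfloor> + 5}" nat] by (auto simp: J_def)
  have "numerator S \<omega> n \<in> J" if "expansion S \<omega> \<in> ball x r" for \<omega>
  proof -
    have "\<bar>expansion S \<omega> - x\<bar> < 2 / 2 ^ n"
      using that assms by (simp add: dist_real_def power_divide abs_minus_commute)
    then have "\<bar>2 ^ n * expansion S \<omega> - 2 ^ n * x\<bar> < 2"
      by (simp flip: right_diff_distrib add: abs_mult pos_less_divide_eq) (simp add: mult.commute)
    moreover have "real (numerator S \<omega> n) \<le> 2 ^ n * expansion S \<omega>"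
        "2 ^ n * expansion S \<omega> \<le> real (numerator S \<omega> n) + 1"
      using expansion_bounds[of S \<omega> n] by (simp_all add: field_simps)
    ultimately have "a < real (numerator S \<omega> n)" "real (numerator S \<omega> n) < a + 5"
      unfolding a_def by linarith+
    then have "int (numerator S \<omega> n) \<in> {\<lfloor>a\<rfloor> + 1..\<lfloor>a\<rfloor> + 5}" by simp linarith
    then show ?thesis unfolding J_def by (metis image_eqI nat_int)
  qed
  then have "measure coin_space {\<omega>. expansion S \<omega> \<in> ball x r} \<le>
      measure coin_space (\<Union>j\<in>J. {\<omega>. numerator S \<omega> n = j})"
    using J by (intro coin_space.finite_measure_mono sets.finite_UN) auto
  also have "\<dots> \<le> (\<Sum>j\<in>J. measure coin_space {\<omega>. numerator S \<omega> n = j})"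
    using J by (intro coin_space.finite_measure_subadditive_finite) auto
  also have "\<dots> \<le> (\<Sum>j\<in>J. (1 / 2) ^ digit_count S n)" by (intro sum_mono measure_numerator_le)
  also have "\<dots> \<le> 5 * (1 / 2) ^ digit_count S n"
    using J(2) by simp
  finally show ?thesis by (simp add: measure_digit_measure)
qed

lemma expansion_in_support: "expansion S \<omega> \<in> measure_support (digit_measure S)"
proof -
  interpret real_distribution "digit_measure S" by (rule real_distribution_digit_measure)
  have "emeasure (digit_measure S) U > 0" if U: "open U" "expansion S \<omega> \<in> U" for U
  proof -
    obtain r where r: "r > 0" "ball (expansion S \<omega>) r \<subseteq> U" using U by (meson open_contains_ball)
    obtain n where "(1 / 2 :: real) ^ n < r" using real_arch_pow_inv[OF r(1), of "1 / 2"] by auto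
    then have "0 < measure (digit_measure S) (ball (expansion S \<omega>) r)"
      by (intro less_le_trans[OF _ measure_ball_ge]) auto
    also have "\<dots> \<le> measure (digit_measure S) U" using r U by (intro finite_measure_mono) auto
    finally show ?thesis by (simp add: emeasure_eq_measure)
  qed
  then show ?thesis by (simp add: measure_support_def)
qed

lemma emeasure_digit_measure_eq_0:
  assumes "A \<in> sets borel" "\<And>\<omega>. expansion S \<omega> \<notin> A"
  shows "emeasure (digit_measure S) A = 0"
proof -
  have "expansion S -` A = {}" using assms by auto
  then show ?thesis using assms unfolding digit_measure_def by (subst emeasure_distr) auto
qed

text \<open>Points of the support are accessed only as limits of values of
  \<open>expansion\<close>.\<close>

lemma support_digit_measure_approx:
  assumes "x \<in> measure_support (digit_measure S)" "0 < r"
  obtains \<omega> where "expansion S \<omega> \<in> ball x r"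
proof -
  have "emeasure (digit_measure S) (ball x r) \<noteq> 0"
    using assms(1) unfolding measure_support_def by (auto dest!: spec[of _ "ball x r"] simp: assms(2))
  then show ?thesis using emeasure_digit_measure_eq_0[of "ball x r" S] that by auto
qed

lemma support_digit_measure_unit: "measure_support (digit_measure S) \<subseteq> {0..1}"
proof
  fix x assume x: "x \<in> measure_support (digit_measure S)"
  show "x \<in> {0..1}"
  proof (rule ccontr)
    assume "x \<notin> {0..1}"
    then obtain r where r: "0 < r" "ball x r \<subseteq> - {0..1}"
      by (meson Compl_iff closed_atLeastAtMost open_Compl open_contains_ball)
    obtain \<omega> where "expansion S \<omega> \<in> ball x r" using support_digit_measure_approx[OF x r(1)] .
    then show False using r(2) expansion_unit[of S \<omega>] by auto
  qed
qed

lemma dyadic_scale: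
  fixes r :: real
  assumes "0 < r" "r \<le> 2"
  obtains n where "(1 / 2) ^ n < r" "r \<le> 2 * (1 / 2) ^ n"
proof -
  define n where "n = (LEAST n. (1 / 2 :: real) ^ n < r)"
  have ex: "\<exists>n. (1 / 2 :: real) ^ n < r" using real_arch_pow_inv[OF assms(1), of "1 / 2"] by auto
  have "(1 / 2) ^ n < r" unfolding n_def by (rule LeastI_ex[OF ex])
  moreover have "r \<le> 2 * (1 / 2) ^ n"
  proof (cases n)
    case 0
    then show ?thesis using assms by simp
  next
    case (Suc k)
    then have "\<not> (1 / 2) ^ k < r" using not_less_Least[of k "\<lambda>n. (1 / 2 :: real) ^ n < r"] by (simp add: n_def)
    then show ?thesis using Suc by simp
  qed
  ultimately show ?thesis by (rule that)
qed

text \<open>For the lower bound, a value of \<open>expansion\<close> within r / 2 of x serves as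
  centre of a ball of half the radius. This descends one binary level, which costs at most a factor
  2.\<close>

lemma support_ball_bounds:
  assumes x: "x \<in> measure_support (digit_measure S)" and n: "(1 / 2) ^ n < r" "r \<le> 2 * (1 / 2) ^ n"
  shows "2 powr - real (digit_count S n) / 2 \<le> measure (digit_measure S) (ball x r)"
    and "measure (digit_measure S) (ball x r) \<le> 5 * 2 powr - real (digit_count S n)"
proof -
  interpret real_distribution "digit_measure S" by (rule real_distribution_digit_measure)
  have powr: "2 powr - real k = (1 / 2) ^ k" for k :: nat
    by (simp add: powr_minus powr_realpow field_simps)
  have "0 < r" using n(1) by (rule less_trans[rotated]) simp
  then obtain \<omega> where \<omega>: "expansion S \<omega> \<in> ball x (r / 2)"
    using support_digit_measure_approx[OF x, of "r / 2"] by auto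
  have "ball (expansion S \<omega>) (r / 2) \<subseteq> ball x r"
  proof
    fix y assume "y \<in> ball (expansion S \<omega>) (r / 2)"
    then show "y \<in> ball x r" using \<omega> dist_triangle[of x y "expansion S \<omega>"] by simp
  qed
  then have "measure (digit_measure S) (ball (expansion S \<omega>) (r / 2)) \<le> measure (digit_measure S) (ball x r)"
    by (intro finite_measure_mono) auto
  moreover have "(1 / 2) ^ digit_count S (Suc n) \<le> measure (digit_measure S) (ball (expansion S \<omega>) (r / 2))"
    using n by (intro measure_ball_ge) simp
  moreover have "(1 / 2 :: real) ^ (digit_count S n + 1) \<le> (1 / 2) ^ digit_count S (Suc n)"
    by (intro power_decreasing) (auto simp: digit_count_Suc)
  ultimately show "2 powr - real (digit_count S n) / 2 \<le> measure (digit_measure S) (ball x r)"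
    unfolding powr by simp
  show "measure (digit_measure S) (ball x r) \<le> 5 * 2 powr - real (digit_count S n)"
    unfolding powr using n by (intro measure_ball_le)
qed

text \<open>Both radii are replaced by dyadic scales m and n, each within a factor 2. The constant
  10 is the 5 of the upper ball bound times the 2 of the lower one.\<close>

lemma digit_measure_ball_ratio:
  assumes x: "x \<in> measure_support (digit_measure S)" and r: "0 < r" "r \<le> R" "R \<le> 2"
  obtains m n where "m \<le> n" "R / r \<le> 2 * 2 powr (real n - real m)" "2 powr (real n - real m) \<le> 2 * (R / r)"
    "measure (digit_measure S) (ball x R) \<le>
       10 * 2 powr (real (digit_count S n) - real (digit_count S m)) * measure (digit_measure S) (ball x r)"
    "2 powr (real (digit_count S n) - real (digit_count S m)) * measure (digit_measure S) (ball x r) \<le>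
       10 * measure (digit_measure S) (ball x R)"
proof -
  obtain n where n: "(1 / 2) ^ n < r" "r \<le> 2 * (1 / 2) ^ n" using dyadic_scale[of r] r by auto
  obtain m where m: "(1 / 2) ^ m < R" "R \<le> 2 * (1 / 2) ^ m" using dyadic_scale[of R] r by auto
  have "(1 / 2 :: real) ^ Suc n < (1 / 2) ^ m" using n m r by simp
  then have mn: "m \<le> n" using power_decreasing[of "Suc n" m "1 / 2 :: real"] by (cases "m \<le> n") auto
  have powr: "2 powr (real n - real m) = (1 / 2) ^ m / (1 / 2) ^ n"
    by (simp add: powr_diff powr_realpow power_divide)
  have R1: "R / r \<le> 2 * (1 / 2) ^ m / (1 / 2) ^ n"
    using r n m by (intro frac_le) auto
  have R2: "(1 / 2) ^ m / (2 * (1 / 2) ^ n) \<le> R / r"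
    using r n m by (intro frac_le) auto
  let ?P = "2 powr - real (digit_count S n)" and ?Q = "2 powr - real (digit_count S m)"
  let ?D = "2 powr (real (digit_count S n) - real (digit_count S m))"
  have D: "?Q = ?D * ?P" by (simp add: powr_add[symmetric])
  have "measure (digit_measure S) (ball x R) \<le> 5 * (?D * ?P)"
    using support_ball_bounds(2)[OF x m] by (simp only: D)
  also have "\<dots> \<le> 5 * (?D * (2 * measure (digit_measure S) (ball x r)))"
    using support_ball_bounds(1)[OF x n] by (intro mult_left_mono) auto
  finally have 1: "measure (digit_measure S) (ball x R) \<le> 10 * ?D * measure (digit_measure S) (ball x r)" by simp
  have "?D * measure (digit_measure S) (ball x r) \<le> ?D * (5 * ?P)"
    using support_ball_bounds(2)[OF x n] by (intro mult_left_mono) auto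
  also have "\<dots> = 5 * ?Q" by (simp only: D)
  also have "\<dots> \<le> 5 * (2 * measure (digit_measure S) (ball x R))"
    using support_ball_bounds(1)[OF x m] by (intro mult_left_mono) auto
  finally have 2: "?D * measure (digit_measure S) (ball x r) \<le> 10 * measure (digit_measure S) (ball x R)" by simp
  show ?thesis using that[OF mn _ _ 1 2] R1 R2 by (simp add: powr)
qed

lemma uniform_dimension_digit_measure:
  assumes t: "0 \<le> t" and S: "S \<noteq> {}" "uniform_density S t"
  shows "uniform_dimension (digit_measure S) t"
proof -
  interpret real_distribution "digit_measure S" by (rule real_distribution_digit_measure)
  let ?\<mu> = "measure (digit_measure S)" and ?K = "measure_support (digit_measure S)"
  let ?c = "\<lambda>n. real (digit_count S n)"
  have density: "\<exists>C. \<forall>m n. m \<le> n \<longrightarrow> \<bar>?c n - ?c m - t * (real n - real m)\<bar> \<le> e * (real n - real m) + C"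
    if "0 < e" for e
    using S(2) that unfolding uniform_density_def by blast
  show ?thesis
  proof unfold_locales
    show "emeasure (digit_measure S) (- ?K) = 0"
      using closed_measure_support[of "digit_measure S"] expansion_in_support
      by (intro emeasure_digit_measure_eq_0) auto
    obtain k where k: "k \<in> S" using S(1) by blast
    \<comment> \<open>Two distinct points of the support, from all bits set and no bit set, make the
      diameter positive.\<close>
    have "digit S k (\<lambda>_. True) \<le> expansion S (\<lambda>_. True)"
      unfolding expansion_def using sum_le_suminf[OF summable_digit, of "{k}"] digit_bounds by simp
    moreover have "expansion S (\<lambda>_. False) = 0" by (simp add: expansion_def digit_def)
    moreover have "bounded ?K" using support_digit_measure_unit bounded_closed_interval by (rule bounded_subset[rotated])
    then have "dist (expansion S (\<lambda>_. True)) (expansion S (\<lambda>_. False)) \<le> diameter ?K"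
      by (intro diameter_bounded_bound expansion_in_support)
    moreover have "0 < digit S k (\<lambda>_. True)" using k by (simp add: digit_def)
    ultimately show "0 < diameter ?K" by (simp add: dist_real_def)
  next
    fix s assume s: "t < s"
    \<comment> \<open>With tolerance \<open>s - t\<close> the digit count of a window is at most s
      times its length plus C. The factor \<open>2 powr s\<close> in the final constant comes from
      rounding the radii.\<close>
    obtain C where C: "\<And>m n. m \<le> n \<Longrightarrow> \<bar>?c n - ?c m - t * (real n - real m)\<bar> \<le> (s - t) * (real n - real m) + C"
      using density[of "s - t"] s by auto
    have "?\<mu> (ball x R) \<le> (10 * 2 powr C * 2 powr s) * (R / r) powr s * ?\<mu> (ball x r)"
      if x: "x \<in> ?K" and r: "0 < r" "r \<le> R" "R \<le> 2" for x r R
    proof -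
      obtain m n where mn: "m \<le> n" "2 powr (real n - real m) \<le> 2 * (R / r)"
          "?\<mu> (ball x R) \<le> 10 * 2 powr (?c n - ?c m) * ?\<mu> (ball x r)"
        using digit_measure_ball_ratio[OF x r] by metis
      have "2 powr (?c n - ?c m) \<le> 2 powr (s * (real n - real m) + C)"
        using C[OF mn(1)] by (intro powr_mono) (auto simp: algebra_simps)
      also have "\<dots> = (2 powr (real n - real m)) powr s * 2 powr C"
        by (simp add: powr_add powr_powr mult.commute)
      also have "\<dots> \<le> (2 * (R / r)) powr s * 2 powr C"
        using mn(2) t s by (intro mult_right_mono powr_mono2) auto
      also have "\<dots> = 2 powr C * 2 powr s * (R / r) powr s" using r by (simp add: powr_mult powr_divide)
      finally have "10 * 2 powr (?c n - ?c m) * ?\<mu> (ball x r) \<le> 10 * (2 powr C * 2 powr s * (R / r) powr s) * ?\<mu> (ball x r)"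
        by (intro mult_right_mono mult_left_mono) auto
      then show ?thesis using mn(3) by (simp add: mult_ac)
    qed
    then show "\<exists>C>0. \<forall>x\<in>?K. \<forall>r R. 0 < r \<and> r \<le> R \<and> R \<le> 2 \<longrightarrow>
        ?\<mu> (ball x R) \<le> C * (R / r) powr s * ?\<mu> (ball x r)"
      by (intro exI[of _ "10 * 2 powr C * 2 powr s"]) auto
  next
    fix s assume s: "0 < s" "s < t"
    obtain C where C: "\<And>m n. m \<le> n \<Longrightarrow> \<bar>?c n - ?c m - t * (real n - real m)\<bar> \<le> (t - s) * (real n - real m) + C"
      using density[of "t - s"] s by auto
    have "1 / (10 * 2 powr C * 2 powr s) * (R / r) powr s * ?\<mu> (ball x r) \<le> ?\<mu> (ball x R)"
      if x: "x \<in> ?K" and r: "0 < r" "r \<le> R" "R \<le> 2" for x r R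
    proof -
      obtain m n where mn: "m \<le> n" "R / r \<le> 2 * 2 powr (real n - real m)"
          "2 powr (?c n - ?c m) * ?\<mu> (ball x r) \<le> 10 * ?\<mu> (ball x R)"
        using digit_measure_ball_ratio[OF x r] by metis
      have "(R / r) powr s \<le> (2 * 2 powr (real n - real m)) powr s"
        using mn(2) s r by (intro powr_mono2) auto
      also have "\<dots> = 2 powr s * (2 powr C * 2 powr (s * (real n - real m) - C))"
        by (simp add: powr_mult powr_powr powr_add[symmetric] mult.commute)
      also have "\<dots> \<le> 2 powr s * (2 powr C * 2 powr (?c n - ?c m))"
        using C[OF mn(1)] by (intro mult_left_mono powr_mono) (auto simp: algebra_simps)
      finally have "(R / r) powr s * ?\<mu> (ball x r) \<le> 2 powr s * (2 powr C * 2 powr (?c n - ?c m)) * ?\<mu> (ball x r)"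
        by (intro mult_right_mono) auto
      also have "\<dots> \<le> 2 powr s * 2 powr C * (10 * ?\<mu> (ball x R))"
        using mn(3) by (simp add: mult.assoc)
      finally show ?thesis by (simp add: field_simps)
    qed
    then show "\<exists>C>0. \<forall>x\<in>?K. \<forall>r R. 0 < r \<and> r \<le> R \<and> R \<le> 2 \<longrightarrow>
        C * (R / r) powr s * ?\<mu> (ball x r) \<le> ?\<mu> (ball x R)"
      by (intro exI[of _ "1 / (10 * 2 powr C * 2 powr s)"]) auto
  qed (use t support_digit_measure_unit in auto)
qed

section \<open>Characteristic functions\<close>

lemma indep_vars_digit: "coin_space.indep_vars (\<lambda>_. borel) (digit S) A"
proof -
  have "coin_space.indep_vars (\<lambda>_. measure_pmf (pmf_of_set UNIV)) (\<lambda>k \<omega>. \<omega> k) UNIV"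
  proof (subst coin_space.indep_vars_iff_distr_eq_PiM)
    have "distr coin_space (Pi\<^sub>M UNIV (\<lambda>_. measure_pmf (pmf_of_set UNIV))) (\<lambda>\<omega>. \<lambda>k\<in>UNIV. \<omega> k) = coin_space"
      unfolding coin_space_def by (simp add: restrict_UNIV distr_id2)
    moreover have "distr coin_space (measure_pmf (pmf_of_set UNIV)) (\<lambda>\<omega>. \<omega> k) = measure_pmf (pmf_of_set UNIV)" for k
      unfolding coin_space_def by (rule coins.PiM_component) simp
    ultimately show "distr coin_space (Pi\<^sub>M UNIV (\<lambda>_. measure_pmf (pmf_of_set UNIV))) (\<lambda>\<omega>. \<lambda>k\<in>UNIV. \<omega> k) =
        Pi\<^sub>M UNIV (\<lambda>k. distr coin_space (measure_pmf (pmf_of_set UNIV)) (\<lambda>\<omega>. \<omega> k))"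
      by (simp add: coin_space_def)
  qed (use measurable_coin in simp_all)
  then have "coin_space.indep_vars (\<lambda>_. borel) (\<lambda>k \<omega>. (\<lambda>b. of_bool (k \<in> S \<and> b) * (1 / 2) ^ Suc k) (\<omega> k) :: real) UNIV"
    by (rule coin_space.indep_vars_compose2) simp
  then have "coin_space.indep_vars (\<lambda>_. borel) (digit S) UNIV"
    unfolding digit_def by simp
  then show ?thesis by (rule coin_space.indep_vars_subset) simp
qed

text \<open>The characteristic function of a fair bit of weight
  \<open>1 / 2 ^ Suc k\<close>.\<close>

definition digit_char :: "nat \<Rightarrow> real \<Rightarrow> complex" where
  "digit_char k u = (1 + iexp (u / 2 ^ Suc k)) / 2"

lemma char_digit: "char (distr coin_space borel (digit S k)) u = (if k \<in> S then digit_char k u else 1)"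
proof -
  have "char (distr coin_space borel (digit S k)) u = (CLINT \<omega>|coin_space. iexp (u * digit S k \<omega>))"
    by (simp add: char_def integral_distr)
  also have "\<dots> = (CLINT b|distr coin_space (measure_pmf (pmf_of_set UNIV)) (\<lambda>\<omega>. \<omega> k).
      iexp (u * (of_bool (k \<in> S \<and> b) * (1 / 2) ^ Suc k)))"
    by (subst integral_distr) (auto simp: digit_def)
  also have "distr coin_space (measure_pmf (pmf_of_set UNIV)) (\<lambda>\<omega>. \<omega> k) = measure_pmf (pmf_of_set UNIV)"
    unfolding coin_space_def by (rule coins.PiM_component) simp
  also have "(CLINT b|measure_pmf (pmf_of_set UNIV). iexp (u * (of_bool (k \<in> S \<and> b) * (1 / 2) ^ Suc k))) =
      (if k \<in> S then digit_char k u else 1)"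
    by (subst integral_measure_pmf[of UNIV]) (auto simp: UNIV_bool digit_char_def power_divide scaleR_conv_of_real field_simps)
  finally show ?thesis .
qed

lemma char_partial_expansion:
  "char (distr coin_space borel (\<lambda>\<omega>. \<Sum>k<n. digit S k \<omega>)) u = (\<Prod>k\<in>S \<inter> {..<n}. digit_char k u)"
proof -
  have "char (distr coin_space borel (\<lambda>\<omega>. \<Sum>k<n. digit S k \<omega>)) u = (\<Prod>k<n. if k \<in> S then digit_char k u else 1)"
    by (simp add: coin_space.char_distr_sum[OF indep_vars_digit] char_digit)
  also have "\<dots> = (\<Prod>k\<in>S \<inter> {..<n}. digit_char k u)"
    by (simp add: prod.inter_restrict[symmetric] Int_commute)
  finally show ?thesis .
qed

text \<open>The infinite product for the characteristic function, by dominated convergence of the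
  partial sums. It yields both the weak convergence of the Moran convolutions and the cosine
  products of the spectrum.\<close>

lemma char_digit_measure:
  "(\<lambda>n. \<Prod>k\<in>S \<inter> {..<n}. digit_char k u) \<longlonglongrightarrow> char (digit_measure S) u"
proof -
  have lim: "(\<lambda>n. \<Sum>k<n. digit S k \<omega>) \<longlonglongrightarrow> expansion S \<omega>" for \<omega>
    unfolding expansion_def using summable_digit summable_LIMSEQ by blast
  have "(\<lambda>n. CLINT \<omega>|coin_space. iexp (u * (\<Sum>k<n. digit S k \<omega>))) \<longlonglongrightarrow> (CLINT \<omega>|coin_space. iexp (u * expansion S \<omega>))"
  proof (rule integral_dominated_convergence[where w="\<lambda>_. 1"])
    show "AE \<omega> in coin_space. (\<lambda>n. iexp (u * (\<Sum>k<n. digit S k \<omega>))) \<longlonglongrightarrow> iexp (u * expansion S \<omega>)"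
      by (intro AE_I2 tendsto_intros lim)
  qed simp_all
  moreover have "(CLINT \<omega>|coin_space. iexp (u * (\<Sum>k<n. digit S k \<omega>))) = (\<Prod>k\<in>S \<inter> {..<n}. digit_char k u)" for n
    unfolding char_partial_expansion[symmetric] by (simp add: char_def integral_distr)
  moreover have "(CLINT \<omega>|coin_space. iexp (u * expansion S \<omega>)) = char (digit_measure S) u"
    by (simp add: char_def digit_measure_def integral_distr)
  ultimately show ?thesis by simp
qed

section \<open>The Moran structure\<close>

lemma char_convolution:
  assumes M: "real_distribution M" and N: "real_distribution N"
  shows "char (convolution M N) u = char M u * char N u"
proof -
  interpret M: real_distribution M by fact
  interpret N: real_distribution N by fact
  interpret pair_sigma_finite M N ..
  have "char (convolution M N) u = (CLINT p|M \<Otimes>\<^sub>M N. iexp (u * fst p) * iexp (u * snd p))"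
    unfolding char_def convolution_def
    by (subst integral_distr) (auto simp: case_prod_beta exp_add[symmetric] algebra_simps)
  also have "\<dots> = (CLINT x|M. CLINT y|N. iexp (u * x) * iexp (u * y))"
  proof (subst integral_fst'[symmetric])
    interpret P: prob_space "M \<Otimes>\<^sub>M N"
      by (rule prob_space_pair) unfold_locales
    show "integrable (M \<Otimes>\<^sub>M N) (\<lambda>p. iexp (u * fst p) * iexp (u * snd p))"
      by (rule P.integrable_const_bound[where B=1]) (auto simp: norm_mult)
  qed simp
  also have "\<dots> = char M u * char N u" by (simp add: char_def)
  finally show ?thesis .
qed

lemma real_distribution_convolution:
  assumes M: "real_distribution M" and N: "real_distribution N"
  shows "real_distribution (convolution M N)"
proof -
  interpret M: real_distribution M by fact
  interpret N: real_distribution N by fact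
  interpret P: prob_space "M \<Otimes>\<^sub>M N"
    by (rule prob_space_pair) unfold_locales
  show ?thesis unfolding convolution_def by (rule P.real_distribution_distr) measurable
qed

lemma real_distribution_uniform_dirac: "real_distribution (uniform_dirac E)"
  unfolding uniform_dirac_def by (rule prob_space.real_distribution_distr[OF prob_space_measure_pmf]) simp

lemma char_uniform_dirac:
  assumes "finite E" "E \<noteq> {}"
  shows "char (uniform_dirac E) u = (\<Sum>e\<in>E. iexp (u * e)) / card E"
proof -
  have "char (uniform_dirac E) u = (CLINT e|measure_pmf (pmf_of_set E). iexp (u * e))"
    by (simp add: char_def uniform_dirac_def integral_distr)
  also have "\<dots> = (\<Sum>e\<in>E. iexp (u * e)) / card E"
    using assms by (subst integral_measure_pmf[of E]) (auto simp: scaleR_conv_of_real sum_divide_distrib indicator_def)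
  finally show ?thesis .
qed

lemma real_distribution_moran_convolution: "real_distribution (moran_convolution b q n)"
proof (induction n)
  case 0
  show ?case by (auto intro!: prob_space_return simp: real_distribution_def real_distribution_axioms_def)
next
  case (Suc n)
  then show ?case by (simp add: real_distribution_convolution real_distribution_uniform_dirac)
qed

text \<open>The generating function of binary representation: every d below \<open>2 ^ a\<close> is
  a unique sum of distinct powers \<open>2 ^ j\<close> with j < a.\<close>

lemma sum_powers_two_power:
  fixes z :: "'a :: comm_ring_1"
  shows "(\<Sum>d<2 ^ a. z ^ d) = (\<Prod>j<a. 1 + z ^ 2 ^ j)"
proof (induction a)
  case (Suc a)
  have "(\<Sum>d<2 ^ Suc a. z ^ d) = (\<Sum>d<2 ^ a. z ^ d) + (\<Sum>d = 2 ^ a..<2 ^ a + 2 ^ a. z ^ d)"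
    using sum.atLeastLessThan_concat[of 0 "2 ^ a" "2 ^ a + 2 ^ a" "\<lambda>d. z ^ d"]
    by (simp add: lessThan_atLeast0 mult_2)
  also have "(\<Sum>d = 2 ^ a..<2 ^ a + 2 ^ a. z ^ d) = (\<Sum>d<2 ^ a. z ^ (d + 2 ^ a))"
    using sum.shift_bounds_nat_ivl[of "\<lambda>d. z ^ d" 0 "2 ^ a" "2 ^ a"] by (simp add: lessThan_atLeast0)
  also have "\<dots> = z ^ 2 ^ a * (\<Sum>d<2 ^ a. z ^ d)" by (simp add: power_add sum_distrib_left mult.commute)
  finally show ?case using Suc by (simp add: algebra_simps)
qed simp

text \<open>A uniform d below \<open>2 ^ a\<close> consists of a independent fair bits; bit j of
  \<open>d / 2 ^ c\<close> sits at position \<open>k = c - Suc j\<close>.\<close>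

lemma sum_iexp_binary_block:
  assumes "a \<le> c"
  shows "(\<Sum>d<2 ^ a. iexp (u * (real d / 2 ^ c))) = 2 ^ a * (\<Prod>k\<in>{c - a..<c}. digit_char k u)"
proof -
  have pow: "iexp (u * (real d / 2 ^ c)) = iexp (u / 2 ^ c) ^ d" for d
    by (simp add: exp_of_nat_mult[symmetric] algebra_simps)
  have "(\<Prod>k\<in>{c - a..<c}. 2 * digit_char k u) = (\<Prod>j<a. 1 + iexp (u / 2 ^ c) ^ 2 ^ j)"
  proof (rule prod.reindex_bij_witness[where i="\<lambda>j. c - Suc j" and j="\<lambda>k. c - Suc k"])
    fix k assume k: "k \<in> {c - a..<c}"
    then have c: "c = Suc k + (c - Suc k)" by simp
    have "iexp (u / 2 ^ c) ^ 2 ^ (c - Suc k) = iexp (u * (real (2 ^ (c - Suc k)) / 2 ^ c))" by (rule pow[symmetric])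
    also have "u * (real (2 ^ (c - Suc k)) / 2 ^ c) = u / 2 ^ Suc k"
    proof -
      have "(2 :: real) ^ c = 2 ^ Suc k * 2 ^ (c - Suc k)" using c by (metis power_add)
      then show ?thesis by (simp del: power_Suc)
    qed
    finally show "1 + iexp (u / 2 ^ c) ^ 2 ^ (c - Suc k) = 2 * digit_char k u"
      by (simp add: digit_char_def)
  qed (use assms in auto)
  moreover have "(\<Prod>k\<in>{c - a..<c}. 2 * digit_char k u) = 2 ^ a * (\<Prod>k\<in>{c - a..<c}. digit_char k u)"
    using assms by (simp add: prod.distrib)
  ultimately show ?thesis unfolding pow by (simp add: sum_powers_two_power)
qed

text \<open>A maximal run of elements of \<open>S\<close>, together with the gap before it, is one digit of the
  Moran measure: the run of length \<open>a\<close> ending at position \<open>c\<close> contributes \<open>d / 2 ^ c\<close> with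
  \<open>d < 2 ^ a\<close>.\<close>

lemma moran_measure_digit_measure:
  assumes S: "infinite S" "infinite (- S)" "0 \<notin> S"
  shows "moran_measure (digit_measure S)"
proof -
  define G where "G = {k \<in> S. Suc k \<notin> S}"
  have ex_G: "\<exists>k\<ge>n. k \<in> G" for n
  proof -
    obtain m where m: "m \<ge> n" "m \<in> S" using S(1) by (metis infinite_nat_iff_unbounded_le)
    have ex: "\<exists>l. m < l \<and> l \<notin> S" using S(2) by (metis infinite_nat_iff_unbounded ComplD)
    define l where "l = (LEAST l. m < l \<and> l \<notin> S)"
    have l: "m < l" "l \<notin> S" using LeastI_ex[OF ex] by (auto simp: l_def)
    have "l - 1 \<in> S"
    proof (cases "l - 1 = m")
      case False
      then show ?thesis using l not_less_Least[of "l - 1" "\<lambda>l. m < l \<and> l \<notin> S"] by (auto simp: l_def[symmetric])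
    qed (use m in simp)
    then have "l - 1 \<in> G" using l by (simp add: G_def)
    then show ?thesis using l m by (intro exI[of _ "l - 1"]) auto
  qed
  then have inf_G: "infinite G" by (simp add: infinite_nat_iff_unbounded_le)
  \<comment> \<open>Block n is the interval from \<open>c n\<close> to just before
    \<open>c (Suc n)\<close>. It starts right after the end of a run, or at 0, so its first position
    is always a gap, and its last position ends a run.\<close>
  define c where "c n = (case n of 0 \<Rightarrow> 0 | Suc m \<Rightarrow> Suc (enumerate G m))" for n
  have c_0: "c 0 = 0" by (simp add: c_def)
  have c_less: "c n < c (Suc n)" for n
    using enumerate_step[OF inf_G] by (cases n) (auto simp: c_def)
  have c_start: "c n \<notin> S" for n
    using enumerate_in_set[OF inf_G] S(3) by (cases n) (auto simp: c_def G_def)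
  have c_end: "c (Suc n) - 1 \<in> S" for n
    using enumerate_in_set[OF inf_G] by (auto simp: c_def G_def)
  have c_gap: "k \<notin> G" if "c n \<le> k" "Suc k < c (Suc n)" for n k
  proof
    assume "k \<in> G"
    then obtain m where m: "k = enumerate G m" using enumerate_Ex[OF inf_G] by metis
    have "m < n" using that(2) m by (simp add: c_def enumerate_mono_iff[OF inf_G])
    moreover have "n \<le> m"
      using that(1) m enumerate_mono_iff[OF inf_G] by (cases n) (auto simp: c_def less_eq_Suc_le[symmetric])
    ultimately show False by simp
  qed
  \<comment> \<open>The run of block n begins at the first element of S from \<open>c n\<close> on,
    and a n is its length.\<close>
  define a where "a n = c (Suc n) - (LEAST k. c n \<le> k \<and> k \<in> S)" for n
  have block: "0 < a n \<and> a n < c (Suc n) - c n \<and> S \<inter> {c n..<c (Suc n)} = {c (Suc n) - a n..<c (Suc n)}" for n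
  proof -
    define l where "l = (LEAST k. c n \<le> k \<and> k \<in> S)"
    have wit: "c n \<le> c (Suc n) - 1 \<and> c (Suc n) - 1 \<in> S" using c_less[of n] c_end[of n] by simp
    have l: "c n \<le> l" "l \<in> S" using LeastI[of "\<lambda>k. c n \<le> k \<and> k \<in> S", OF wit] by (auto simp: l_def)
    have "l \<le> c (Suc n) - 1" using Least_le[of "\<lambda>k. c n \<le> k \<and> k \<in> S", OF wit] by (simp add: l_def)
    then have l_less: "l < c (Suc n)" using c_less[of n] by linarith
    \<comment> \<open>The run is strictly shorter than its block, which is what makes
      \<open>q\<close> strictly smaller than \<open>b\<close>.\<close>
    have "l \<noteq> c n" using l c_start[of n] by auto
    \<comment> \<open>Leaving S before the end of the block would put an element of G inside
      it.\<close>
    have up: "k \<in> S" if "l \<le> k" "k < c (Suc n)" for k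
      using that
    proof (induction k rule: dec_induct)
      case (step k)
      then have "k \<in> S" "k \<notin> G" using c_gap[of n k] l by auto
      then show ?case by (simp add: G_def)
    qed (rule l)
    have "S \<inter> {c n..<c (Suc n)} = {l..<c (Suc n)}"
    proof (intro equalityI subsetI)
      fix k assume k: "k \<in> S \<inter> {c n..<c (Suc n)}"
      then have "l \<le> k" unfolding l_def by (intro Least_le) auto
      then show "k \<in> {l..<c (Suc n)}" using k by auto
    qed (use up l in auto)
    moreover have "a n = c (Suc n) - l" by (simp add: a_def l_def)
    ultimately show ?thesis using l l_less \<open>l \<noteq> c n\<close> by auto
  qed
  \<comment> \<open>Block n - 1 supplies the Moran digit n, as Moran sequences are indexed from 1.
    The products of b telescope to \<open>2 ^ c n\<close>.\<close>
  define b where "b n = (2 :: nat) ^ (c n - c (n - 1))" for n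
  define q where "q n = (2 :: nat) ^ a (n - 1)" for n
  have prod_b: "(\<Prod>j = 1..n. real (b j)) = 2 ^ c n" for n
  proof (induction n)
    case (Suc n)
    have "(\<Prod>j = 1..Suc n. real (b j)) = 2 ^ c n * 2 ^ (c (Suc n) - c n)"
      using Suc by (simp add: b_def)
    also have "\<dots> = 2 ^ c (Suc n)"
      using c_less[of n] by (subst power_add[symmetric]) simp
    finally show ?case .
  qed (simp add: c_0)
  have char_digits: "char (uniform_dirac (moran_digits b q (Suc n))) u = (\<Prod>k\<in>S \<inter> {c n..<c (Suc n)}. digit_char k u)" for n u
  proof -
    let ?f = "\<lambda>d. real d / 2 ^ c (Suc n)"
    have digits: "moran_digits b q (Suc n) = ?f ` {..<2 ^ a n}"
      by (simp only: moran_digits_def prod_b) (simp add: q_def lessThan_atLeast0)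
    have inj: "inj_on ?f {..<2 ^ a n}" by (auto simp: inj_on_def)
    have "char (uniform_dirac (moran_digits b q (Suc n))) u = (\<Sum>d<2 ^ a n. iexp (u * ?f d)) / 2 ^ a n"
      unfolding digits by (subst char_uniform_dirac) (auto simp: card_image[OF inj] sum.reindex[OF inj] lessThan_empty_iff)
    also have "\<dots> = (\<Prod>k\<in>{c (Suc n) - a n..<c (Suc n)}. digit_char k u)"
      using block[of n] by (subst sum_iexp_binary_block) auto
    finally show ?thesis using block[of n] by simp
  qed
  have char_conv: "char (moran_convolution b q n) u = (\<Prod>k\<in>S \<inter> {..<c n}. digit_char k u)" for n u
  proof (induction n)
    case 0
    then show ?case by (simp add: c_0 char_def integral_return)
  next
    case (Suc n)
    have "S \<inter> {..<c (Suc n)} = (S \<inter> {..<c n}) \<union> (S \<inter> {c n..<c (Suc n)})"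
      unfolding Int_Un_distrib[symmetric] using c_less[of n] by (subst ivl_disj_un_one(2)) auto
    moreover have "(S \<inter> {..<c n}) \<inter> (S \<inter> {c n..<c (Suc n)}) = {}" by auto
    ultimately have "(\<Prod>k\<in>S \<inter> {..<c (Suc n)}. digit_char k u) =
        (\<Prod>k\<in>S \<inter> {..<c n}. digit_char k u) * (\<Prod>k\<in>S \<inter> {c n..<c (Suc n)}. digit_char k u)"
      using prod.union_disjoint[of "S \<inter> {..<c n}" "S \<inter> {c n..<c (Suc n)}" "\<lambda>k. digit_char k u"] by simp
    then show ?case
      using Suc by (simp add: char_convolution real_distribution_moran_convolution
          real_distribution_uniform_dirac char_digits)
  qed
  \<comment> \<open>The Moran convolutions realise the subsequence of partial products cut at block
    ends; Levy's theorem turns convergence of these into weak convergence.\<close>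
  have "strict_mono c" by (simp add: strict_mono_Suc_iff c_less)
  then have "(\<lambda>n. char (moran_convolution b q n) u) \<longlonglongrightarrow> char (digit_measure S) u" for u
    using LIMSEQ_subseq_LIMSEQ[OF char_digit_measure[where S=S and u=u], of c] unfolding char_conv by (simp add: o_def)
  then have "weak_conv_m (moran_convolution b q) (digit_measure S)"
    by (intro levy_continuity real_distribution_moran_convolution real_distribution_digit_measure)
  moreover have "2 \<le> q n \<and> q n < b n" if pos: "n \<ge> 1" for n
  proof -
    obtain m where n: "n = Suc m" using pos by (cases n) auto
    have "(2 :: nat) ^ 1 \<le> 2 ^ a m" using block[of m] by (intro power_increasing) auto
    moreover have "(2 :: nat) ^ a m < 2 ^ (c (Suc m) - c m)" using block[of m] by (intro power_strict_increasing) auto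
    ultimately show ?thesis by (simp add: n q_def b_def)
  qed
  ultimately show ?thesis
    unfolding moran_measure_def using real_distribution_digit_measure by blast
qed

section \<open>The spectrum\<close>

text \<open>The squared modulus of the n-th partial product of the characteristic function, taken at
  -2 \<pi> x.\<close>

definition mask :: "nat set \<Rightarrow> nat \<Rightarrow> real \<Rightarrow> real" where
  "mask S n x = (\<Prod>k\<in>S \<inter> {..<n}. (cos (pi * x / 2 ^ Suc k))\<^sup>2)"

primrec frequencies :: "nat set \<Rightarrow> nat \<Rightarrow> real set" where
  "frequencies S 0 = {0}"
| "frequencies S (Suc n) = (if n \<in> S then frequencies S n \<union> (\<lambda>l. l + 2 ^ n) ` frequencies S n else frequencies S n)"

lemma mask_0 [simp]: "mask S 0 x = 1"
  by (simp add: mask_def)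

lemma mask_Suc: "mask S (Suc n) x = mask S n x * (if n \<in> S then (cos (pi * x / 2 ^ Suc n))\<^sup>2 else 1)"
  by (auto simp: mask_def lessThan_Suc Int_insert_right mult.commute)

lemma mask_nonneg: "0 \<le> mask S n x"
  unfolding mask_def by (intro prod_nonneg) auto

lemma decseq_mask: "decseq (\<lambda>n. mask S n x)"
proof (rule decseq_SucI)
  fix n
  have "(cos (pi * x / 2 ^ Suc n))\<^sup>2 \<le> 1" by (simp add: abs_square_le_1)
  then show "mask S (Suc n) x \<le> mask S n x"
    using mult_left_mono[of "(cos (pi * x / 2 ^ Suc n))\<^sup>2" 1 "mask S n x"] mask_nonneg[of S n x] by (simp add: mask_Suc)
qed

text \<open>Each factor below level n has its angle shifted by an integer multiple of \<pi>, a
  period of the squared cosine.\<close>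

lemma mask_add_power: "mask S n (x + 2 ^ n) = mask S n x"
  unfolding mask_def
proof (rule prod.cong[OF refl])
  fix k assume "k \<in> S \<inter> {..<n}"
  then have "n = Suc k + (n - Suc k)" by simp
  then have "(2 :: real) ^ n = 2 ^ Suc k * 2 ^ (n - Suc k)" by (metis power_add)
  then have "pi * (x + 2 ^ n) / 2 ^ Suc k = pi * x / 2 ^ Suc k + pi * real (2 ^ (n - Suc k))"
    by (simp add: field_simps)
  moreover have "(cos (\<theta> + pi * real m))\<^sup>2 = (cos \<theta>)\<^sup>2" for \<theta> m
    by (simp add: cos_add power_mult_distrib flip: power_mult)
  ultimately show "(cos (pi * (x + 2 ^ n) / 2 ^ Suc k))\<^sup>2 = (cos (pi * x / 2 ^ Suc k))\<^sup>2" by (simp only:)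
qed

lemma frequencies_bounds: "l \<in> frequencies S n \<Longrightarrow> 0 \<le> l \<and> l < 2 ^ n"
  by (induction n arbitrary: l) (force split: if_splits)+

lemma finite_frequencies [simp]: "finite (frequencies S n)"
  by (induction n) auto

lemma frequencies_mono: "m \<le> n \<Longrightarrow> frequencies S m \<subseteq> frequencies S n"
  by (induction n rule: dec_induct) auto

text \<open>Shifting by \<open>2 ^ n\<close> adds \<pi> / 2 to the angle of the new factor only. The
  two copies of the old frequencies thus carry complementary weights, a squared cosine and a squared
  sine, and the total is unchanged. This is Parseval's identity at a finite level.\<close>

lemma sum_mask_frequencies: "(\<Sum>l\<in>frequencies S n. mask S n (x + l)) = 1"
proof (induction n)
  case (Suc n)
  show ?case
  proof (cases "n \<in> S")
    case True
    let ?c = "\<lambda>y. (cos (pi * y / 2 ^ Suc n))\<^sup>2"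
    have shift: "?c (y + 2 ^ n) = 1 - ?c y" for y
    proof -
      have "pi * (y + 2 ^ n) / 2 ^ Suc n = pi * y / 2 ^ Suc n + pi / 2" by (simp add: field_simps)
      then show ?thesis by (simp only: cos_add) (simp add: cos_squared_eq)
    qed
    have disj: "frequencies S n \<inter> (\<lambda>l. l + 2 ^ n) ` frequencies S n = {}"
    proof -
      have "l + 2 ^ n \<notin> frequencies S n" if "l \<in> frequencies S n" for l
        using frequencies_bounds[of l S n] frequencies_bounds[of "l + 2 ^ n" S n] that by auto
      then show ?thesis by auto
    qed
    have "(\<Sum>l\<in>frequencies S (Suc n). mask S (Suc n) (x + l)) =
        (\<Sum>l\<in>frequencies S n. mask S n (x + l) * ?c (x + l)) +
        (\<Sum>l\<in>frequencies S n. mask S n (x + l + 2 ^ n) * ?c (x + l + 2 ^ n))"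
      using True disj by (simp add: sum.union_disjoint sum.reindex mask_Suc add.assoc)
    also have "\<dots> = (\<Sum>l\<in>frequencies S n. mask S n (x + l))"
      unfolding mask_add_power shift sum.distrib[symmetric]
      by (intro sum.cong) (simp_all add: algebra_simps)
    finally show ?thesis using Suc by simp
  qed (use Suc in \<open>simp add: mask_Suc\<close>)
qed simp

text \<open>In the finite-level identity at x = -l' the term of l' alone is already 1, so every
  other nonnegative term vanishes.\<close>

lemma mask_diff_frequencies:
  assumes "l \<in> frequencies S n" "l' \<in> frequencies S n" "l \<noteq> l'"
  shows "mask S n (l - l') = 0"
proof -
  have "(\<Sum>k\<in>{l, l'}. mask S n (- l' + k)) \<le> (\<Sum>k\<in>frequencies S n. mask S n (- l' + k))"
    using assms mask_nonneg by (intro sum_mono2) auto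
  also have "\<dots> = 1" by (rule sum_mask_frequencies)
  finally have "mask S n (l - l') + 1 \<le> 1" using assms(3) by (simp add: mask_def)
  then show ?thesis using mask_nonneg[of S n "l - l'"] by linarith
qed

text \<open>The Weierstrass product inequality, used to keep the product of the remaining cosines
  away from 0.\<close>

lemma prod_ge_1_minus_sum:
  fixes a :: "'i \<Rightarrow> real"
  assumes "\<And>i. i \<in> A \<Longrightarrow> 0 \<le> a i \<and> a i \<le> 1"
  shows "1 - (\<Sum>i\<in>A. a i) \<le> (\<Prod>i\<in>A. 1 - a i)"
  using assms
proof (induction A rule: infinite_finite_induct)
  case (insert i A)
  have "(1 - a i) * (1 - (\<Sum>i\<in>A. a i)) \<le> (1 - a i) * (\<Prod>i\<in>A. 1 - a i)"
    using insert by (intro mult_left_mono) auto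
  moreover have "0 \<le> a i * (\<Sum>i\<in>A. a i)" using insert.prems by (intro mult_nonneg_nonneg sum_nonneg) auto
  ultimately show ?case using insert.hyps by (simp add: algebra_simps)
qed auto

lemma cos_ge_1_minus_square: "1 - x\<^sup>2 / 2 \<le> cos (x :: real)"
proof -
  have "(sin (x / 2))\<^sup>2 \<le> (x / 2)\<^sup>2"
    using abs_sin_x_le_abs_x[of "x / 2"] unfolding abs_le_square_iff .
  moreover have "cos x = 1 - 2 * (sin (x / 2))\<^sup>2" using cos_double_sin[of "x / 2"] by simp
  ultimately show ?thesis by (simp add: power_divide)
qed

text \<open>At a position \<open>n\<close> outside \<open>S\<close> the factors that remain beyond level \<open>n\<close> start only at
  \<open>k = n + 1\<close>, hence stay away from the zeros of the cosine.
  Since \<open>\<pi> < 4\<close>, the deficits \<open>a k\<close> below add up to at most \<open>27 / 32 < 7 / 8\<close>, and \<open>64\<close> is the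
  square of \<open>8\<close>.\<close>

lemma mask_tail:
  assumes n: "n \<notin> S" "n \<le> N" and y: "\<bar>y\<bar> \<le> 9 / 8 * 2 ^ n"
  shows "mask S n y \<le> 64 * mask S N y"
proof -
  let ?A = "S \<inter> {n..<N}"
  define a where "a k = (pi * y / 2 ^ Suc k)\<^sup>2 / 2" for k
  have four: "(4 :: real) ^ m = (2 ^ m)\<^sup>2" for m
    by (simp add: power2_eq_square flip: power_mult_distrib)
  \<comment> \<open>81 / 32 is (4 * 9 / 8)^2 / 8: the 4 bounds \<pi>, and the 8 combines one factor
    4 of \<open>4 ^ Suc k\<close> with the halving in \<open>a\<close>.\<close>
  have a_le: "a k \<le> 81 / 32 * (1 / 4) ^ (k - n)" if "n < k" for k
  proof -
    have k: "(4 :: real) ^ k = 4 ^ n * 4 ^ (k - n)"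
      using that by (simp flip: power_add)
    have "pi * \<bar>y\<bar> \<le> 4 * (9 / 8 * 2 ^ n)" using y pi_less_4 pi_gt_zero by (intro mult_mono) auto
    then have "(pi * \<bar>y\<bar>)\<^sup>2 \<le> (4 * (9 / 8 * 2 ^ n))\<^sup>2" by (intro power_mono) auto
    then have "(pi * y)\<^sup>2 \<le> 81 / 4 * 4 ^ n"
      unfolding four power_mult_distrib by (simp add: power2_eq_square)
    then have "(pi * y)\<^sup>2 / 4 ^ Suc k / 2 \<le> 81 / 4 * 4 ^ n / 4 ^ Suc k / 2"
      by (intro divide_right_mono) auto
    then have "a k \<le> 81 / 4 * 4 ^ n / 4 ^ Suc k / 2"
      unfolding a_def power_divide four[symmetric] .
    also have "\<dots> = 81 / 32 * (1 / 4) ^ (k - n)"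
      by (simp add: k power_divide)
    finally show ?thesis .
  qed
  have a_bounds: "0 \<le> a k" "n < k \<Longrightarrow> a k \<le> 1" for k
  proof -
    show "0 \<le> a k" by (simp add: a_def)
    assume "n < k"
    moreover have "(1 / 4 :: real) ^ (k - n) \<le> (1 / 4) ^ 1"
      using \<open>n < k\<close> by (intro power_decreasing) auto
    ultimately show "a k \<le> 1" using a_le[of k] by simp
  qed
  have A_gt: "n < k" if "k \<in> ?A" for k
    using that n(1) by (cases "k = n") auto
  \<comment> \<open>Partial sums of the geometric series with limit (81 / 32) / 3 = 27 / 32. At N =
    n the natural subtraction truncates, and at N = n + 1 it is exactly 0; the bound is 0 in both
    cases and holds because n is not in S.\<close>
  have "(\<Sum>k\<in>?A. a k) \<le> 27 / 32 * (1 - (1 / 4) ^ (N - Suc n))"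
    using n(2)
  proof (induction N rule: dec_induct)
    case (step N)
    show ?case
    proof (cases "N = n")
      case True
      then have "S \<inter> {n..<Suc N} = {}" using n(1) by auto
      then show ?thesis by (simp add: True)
    next
      case False
      then have N: "n < N" "N - n = Suc (N - Suc n)" using step.hyps by auto
      have "(\<Sum>k\<in>S \<inter> {n..<Suc N}. a k) \<le> (\<Sum>k\<in>S \<inter> {n..<N}. a k) + a N"
        using a_bounds(1)[of N] step.hyps by (simp add: atLeastLessThanSuc Int_insert_right)
      also have "\<dots> \<le> 27 / 32 * (1 - (1 / 4) ^ (N - Suc n)) + 81 / 32 * (1 / 4) ^ (N - n)"
        using step.IH a_le[OF N(1)] by (rule add_mono)
      also have "\<dots> = 27 / 32 * (1 - (1 / 4) ^ (Suc N - Suc n))"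
        using N(2) by (simp add: field_simps)
      finally show ?thesis .
    qed
  qed simp
  also have "\<dots> \<le> 27 / 32" by simp
  finally have "1 / 8 \<le> 1 - (\<Sum>k\<in>?A. a k)" by simp
  also have "\<dots> \<le> (\<Prod>k\<in>?A. 1 - a k)"
    using a_bounds A_gt by (intro prod_ge_1_minus_sum) auto
  also have "\<dots> \<le> (\<Prod>k\<in>?A. cos (pi * y / 2 ^ Suc k))"
    using a_bounds A_gt cos_ge_1_minus_square by (intro prod_mono) (auto simp: a_def)
  finally have "(1 / 8)\<^sup>2 \<le> (\<Prod>k\<in>?A. cos (pi * y / 2 ^ Suc k))\<^sup>2" by (intro power_mono) auto
  then have "1 / 64 \<le> (\<Prod>k\<in>?A. (cos (pi * y / 2 ^ Suc k))\<^sup>2)"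
    unfolding prod_power_distrib by (simp add: power2_eq_square)
  then have "mask S n y * (1 / 64) \<le> mask S n y * (\<Prod>k\<in>?A. (cos (pi * y / 2 ^ Suc k))\<^sup>2)"
    by (intro mult_left_mono mask_nonneg)
  also have "\<dots> = mask S N y"
  proof -
    have "S \<inter> {..<N} = (S \<inter> {..<n}) \<union> ?A"
      unfolding Int_Un_distrib[symmetric] using n(2) by (subst ivl_disj_un_one(2)) auto
    moreover have "(S \<inter> {..<n}) \<inter> ?A = {}" by auto
    ultimately show ?thesis
      unfolding mask_def using prod.union_disjoint[of "S \<inter> {..<n}" ?A "\<lambda>k. (cos (pi * y / 2 ^ Suc k))\<^sup>2"] by simp
  qed
  finally show ?thesis by simp
qed

section \<open>The Fourier transform as the limit of the masks\<close>

lemma cmod_digit_char: "(cmod (digit_char k u))\<^sup>2 = (cos (u / 2 ^ Suc k / 2))\<^sup>2"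
proof -
  define \<theta> where "\<theta> = u / 2 ^ Suc k / 2"
  have "digit_char k u = (1 + iexp (2 * \<theta>)) / 2" by (simp add: digit_char_def \<theta>_def)
  \<comment> \<open>Half-angle factorisation: the phase has modulus 1 and only the cosine
    remains.\<close>
  also have "\<dots> = iexp \<theta> * cos \<theta>"
    by (simp add: cos_exp_eq cos_of_real[symmetric] exp_add[symmetric] field_simps exp_minus)
  finally show ?thesis by (simp add: norm_mult \<theta>_def del: power_Suc)
qed

text \<open>The squared modulus of the Fourier transform of the measure; the masks decrease to
  it.\<close>

definition spectral_mask :: "nat set \<Rightarrow> real \<Rightarrow> real" where
  "spectral_mask S x = (cmod (char (digit_measure S) (- 2 * pi * x)))\<^sup>2"

lemma mask_tendsto: "(\<lambda>n. mask S n x) \<longlonglongrightarrow> spectral_mask S x"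
proof -
  have "(cmod (\<Prod>k\<in>S \<inter> {..<n}. digit_char k (- 2 * pi * x)))\<^sup>2 = mask S n x" for n
  proof -
    have "- 2 * pi * x / 2 ^ Suc k / 2 = - (pi * x / 2 ^ Suc k)" for k by simp
    then have "(cmod (digit_char k (- 2 * pi * x)))\<^sup>2 = (cos (pi * x / 2 ^ Suc k))\<^sup>2" for k
      unfolding cmod_digit_char by (simp only: cos_minus)
    then show ?thesis by (simp only: mask_def prod_norm[symmetric] prod_power_distrib[of "\<lambda>k. cmod (digit_char k _)"])
  qed
  then show ?thesis
    using tendsto_power[OF tendsto_norm[OF char_digit_measure[where S=S and u="- 2 * pi * x"]], of 2]
    by (simp add: spectral_mask_def)
qed

lemma spectral_mask_le: "spectral_mask S x \<le> mask S n x"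
  using decseq_ge[OF decseq_mask mask_tendsto] .

lemma spectral_mask_nonneg: "0 \<le> spectral_mask S x"
  by (simp add: spectral_mask_def)

lemma mask_le_spectral_mask:
  assumes "n \<notin> S" "\<bar>y\<bar> \<le> 9 / 8 * 2 ^ n"
  shows "mask S n y \<le> 64 * spectral_mask S y"
proof (rule LIMSEQ_le_const)
  show "(\<lambda>N. 64 * mask S N y) \<longlonglongrightarrow> 64 * spectral_mask S y" by (intro tendsto_intros mask_tendsto)
  show "\<exists>N0. \<forall>N\<ge>N0. mask S n y \<le> 64 * mask S N y" using mask_tail[OF assms(1) _ assms(2)] by blast
qed

text \<open>Jorgensen--Pedersen completeness criterion: the sum equals \<open>1\<close> at each finite level, and the
  tail bound prevents mass from escaping in the limit.\<close>

lemma sum_spectral_mask: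
  assumes S: "infinite (- S)" and \<epsilon>: "0 < \<epsilon>"
  shows "\<exists>m. 1 - \<epsilon> < (\<Sum>l\<in>frequencies S m. spectral_mask S (x + l))"
proof -
  define s where "s m = (\<Sum>l\<in>frequencies S m. spectral_mask S (x + l))" for m
  have "incseq s"
    unfolding s_def using frequencies_mono spectral_mask_nonneg
    by (intro incseq_SucI sum_mono2) auto
  moreover have "s m \<le> 1" for m
  proof -
    have "s m \<le> (\<Sum>l\<in>frequencies S m. mask S m (x + l))"
      unfolding s_def by (intro sum_mono spectral_mask_le)
    then show ?thesis by (simp add: sum_mask_frequencies)
  qed
  ultimately obtain L where L: "s \<longlonglongrightarrow> L" "\<And>i. s i \<le> L" using incseq_convergent[of s 1] by blast
  \<comment> \<open>The argument loses 64 d, from the constant of the tail bound; 65 instead of 64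
    makes the final inequality strict.\<close>
  define d where "d = \<epsilon> / 65"
  have d: "0 < d" using \<epsilon> by (simp add: d_def)
  obtain m where m: "L - d < s m"
    using order_tendstoD(1)[OF L(1), of "L - d"] d by (auto simp: eventually_sequentially)
  \<comment> \<open>Level n is cut at a gap beyond n0. Frequencies already in level m are estimated
    by their masks at n0, to be sent to infinity afterwards in a fixed finite sum. The others are
    charged to the tail of the convergent sequence s, which is below d.\<close>
  have bound: "1 \<le> (\<Sum>l\<in>frequencies S m. mask S n0 (x + l)) + 64 * d" for n0
  proof -
    \<comment> \<open>Ensures \<bar>x\<bar> \<le> 2 ^ n / 8; since frequencies of level n lie in [0,
      2 ^ n), the sum stays below the 9 / 8 * 2 ^ n of the tail bound.\<close>
    obtain p :: nat where p: "8 * \<bar>x\<bar> < 2 ^ p" using real_arch_pow[of 2 "8 * \<bar>x\<bar>"] by auto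
    obtain n where n: "n \<ge> max n0 (max m p)" "n \<notin> S"
      using S by (metis infinite_nat_iff_unbounded_le ComplD)
    have "(2 :: real) ^ p \<le> 2 ^ n" using n by (intro power_increasing) auto
    then have x: "8 * \<bar>x\<bar> \<le> 2 ^ n" using p by linarith
    have sub: "frequencies S m \<subseteq> frequencies S n" using n by (intro frequencies_mono) auto
    have "1 = (\<Sum>l\<in>frequencies S n. mask S n (x + l))" by (rule sum_mask_frequencies[symmetric])
    also have "\<dots> = (\<Sum>l\<in>frequencies S m. mask S n (x + l)) + (\<Sum>l\<in>frequencies S n - frequencies S m. mask S n (x + l))"
      using sum.subset_diff[OF sub finite_frequencies, of "\<lambda>l. mask S n (x + l)"] by simp
    also have "\<dots> \<le> (\<Sum>l\<in>frequencies S m. mask S n0 (x + l)) + (\<Sum>l\<in>frequencies S n - frequencies S m. 64 * spectral_mask S (x + l))"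
    proof (intro add_mono sum_mono)
      fix l
      show "mask S n (x + l) \<le> mask S n0 (x + l)" using decseqD[OF decseq_mask, of n0 n] n by simp
      assume "l \<in> frequencies S n - frequencies S m"
      then have "0 \<le> l" "l < 2 ^ n" using frequencies_bounds[of l S n] by auto
      then have "\<bar>x + l\<bar> \<le> 9 / 8 * 2 ^ n" using x by linarith
      then show "mask S n (x + l) \<le> 64 * spectral_mask S (x + l)" by (intro mask_le_spectral_mask n(2))
    qed
    also have "(\<Sum>l\<in>frequencies S n - frequencies S m. 64 * spectral_mask S (x + l)) = 64 * (s n - s m)"
      unfolding s_def using sum_diff[OF finite_frequencies sub, of "\<lambda>l. spectral_mask S (x + l)"]
      by (simp add: sum_distrib_left[symmetric])
    also have "\<dots> \<le> 64 * d" using L(2)[of n] m by simp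
    finally show ?thesis by simp
  qed
  have "(\<lambda>n. (\<Sum>l\<in>frequencies S m. mask S n (x + l)) + 64 * d) \<longlonglongrightarrow> s m + 64 * d"
    unfolding s_def by (intro tendsto_intros mask_tendsto)
  then have "1 \<le> s m + 64 * d" by (rule LIMSEQ_le_const) (use bound in auto)
  then show ?thesis using \<epsilon> by (intro exI[of _ m]) (simp add: s_def d_def field_simps)
qed

section \<open>Completeness in the Hilbert space\<close>

lemma L2_functionsI:
  "f \<in> borel_measurable M \<Longrightarrow> integrable M (\<lambda>x. (cmod (f x))\<^sup>2) \<Longrightarrow> f \<in> L2_functions M"
  by (simp add: L2_functions_def)

lemma cmod_add_square_le: "(cmod (a + b))\<^sup>2 \<le> 2 * (cmod a)\<^sup>2 + 2 * (cmod b)\<^sup>2"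
proof -
  have "(cmod (a + b))\<^sup>2 \<le> (cmod a + cmod b)\<^sup>2" by (intro power_mono norm_triangle_ineq) auto
  also have "\<dots> \<le> 2 * (cmod a)\<^sup>2 + 2 * (cmod b)\<^sup>2"
    using sum_squares_ge_zero[of "cmod a - cmod b" 0] by (simp add: power2_eq_square algebra_simps)
  finally show ?thesis .
qed

lemma L2_functions_add:
  assumes "f \<in> L2_functions M" "g \<in> L2_functions M"
  shows "(\<lambda>x. f x + g x) \<in> L2_functions M"
proof (rule L2_functionsI)
  have [measurable]: "f \<in> borel_measurable M" "g \<in> borel_measurable M" using assms by (auto simp: L2_functions_def)
  show "(\<lambda>x. f x + g x) \<in> borel_measurable M" by measurable
  show "integrable M (\<lambda>x. (cmod (f x + g x))\<^sup>2)"
  proof (rule Bochner_Integration.integrable_bound)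
    show "integrable M (\<lambda>x. 2 * (cmod (f x))\<^sup>2 + 2 * (cmod (g x))\<^sup>2)"
      using assms by (auto simp: L2_functions_def)
  qed (use cmod_add_square_le in auto)
qed

lemma L2_functions_cmult:
  assumes "f \<in> L2_functions M"
  shows "(\<lambda>x. c * f x) \<in> L2_functions M"
  using assms by (auto simp: L2_functions_def norm_mult power_mult_distrib)

lemma L2_functions_diff:
  assumes "f \<in> L2_functions M" "g \<in> L2_functions M"
  shows "(\<lambda>x. f x - g x) \<in> L2_functions M"
  using L2_functions_add[OF assms(1) L2_functions_cmult[OF assms(2), of "-1"]] by simp

lemma L2_functions_sum:
  assumes "\<And>i. i \<in> A \<Longrightarrow> f i \<in> L2_functions M"
  shows "(\<lambda>x. \<Sum>i\<in>A. f i x) \<in> L2_functions M"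
  using assms
proof (induction A rule: infinite_finite_induct)
  case (insert i A)
  then show ?case using L2_functions_add[of "f i" M "\<lambda>x. \<Sum>i\<in>A. f i x"] by simp
qed (auto intro: L2_functionsI)

section \<open>Squared norms and closed linear spans\<close>

definition L2_sqnorm :: "'a measure \<Rightarrow> ('a \<Rightarrow> complex) \<Rightarrow> real" where
  "L2_sqnorm M f = (LINT x|M. (cmod (f x))\<^sup>2)"

lemma L2_sqnorm_add:
  assumes "f \<in> L2_functions M" "g \<in> L2_functions M"
  shows "L2_sqnorm M (\<lambda>x. f x + g x) \<le> 2 * L2_sqnorm M f + 2 * L2_sqnorm M g"
proof -
  have "L2_sqnorm M (\<lambda>x. f x + g x) \<le> (LINT x|M. 2 * (cmod (f x))\<^sup>2 + 2 * (cmod (g x))\<^sup>2)"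
    unfolding L2_sqnorm_def using assms L2_functions_add[OF assms] cmod_add_square_le
    by (intro integral_mono) (auto simp: L2_functions_def)
  also have "\<dots> = 2 * L2_sqnorm M f + 2 * L2_sqnorm M g"
    unfolding L2_sqnorm_def using assms by (subst Bochner_Integration.integral_add) (auto simp: L2_functions_def)
  finally show ?thesis .
qed

definition L2_span :: "'i set \<Rightarrow> ('i \<Rightarrow> 'a \<Rightarrow> complex) \<Rightarrow> ('a \<Rightarrow> complex) set" where
  "L2_span I e = {\<lambda>x. \<Sum>j\<in>J. c j * e j x | J c. finite J \<and> J \<subseteq> I}"

text \<open>Its elements are functions, not classes modulo null sets; the seminorm performs the
  identification.\<close>

definition L2_closed_span :: "'a measure \<Rightarrow> 'i set \<Rightarrow> ('i \<Rightarrow> 'a \<Rightarrow> complex) \<Rightarrow> ('a \<Rightarrow> complex) set" where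
  "L2_closed_span M I e =
     {f \<in> L2_functions M. \<forall>\<epsilon>>0. \<exists>p\<in>L2_span I e. L2_sqnorm M (\<lambda>x. f x - p x) < \<epsilon>}"

lemma L2_span_add:
  assumes "p \<in> L2_span I e" "p' \<in> L2_span I e"
  shows "(\<lambda>x. p x + p' x) \<in> L2_span I e"
proof -
  obtain J c J' c' where J: "finite J" "J \<subseteq> I" "p = (\<lambda>x. \<Sum>j\<in>J. c j * e j x)"
      "finite J'" "J' \<subseteq> I" "p' = (\<lambda>x. \<Sum>j\<in>J'. c' j * e j x)"
    using assms by (auto simp: L2_span_def)
  define d where "d j = (if j \<in> J then c j else 0) + (if j \<in> J' then c' j else 0)" for j
  have "(\<Sum>j\<in>J \<union> J'. (if j \<in> J then c j else 0) * e j x) = p x" for x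
    unfolding J(3) using J by (intro sum.mono_neutral_cong_right) auto
  moreover have "(\<Sum>j\<in>J \<union> J'. (if j \<in> J' then c' j else 0) * e j x) = p' x" for x
    unfolding J(6) using J by (intro sum.mono_neutral_cong_right) auto
  ultimately have "(\<lambda>x. p x + p' x) = (\<lambda>x. \<Sum>j\<in>J \<union> J'. d j * e j x)"
    by (simp add: d_def algebra_simps sum.distrib)
  then show ?thesis using J unfolding L2_span_def by (intro CollectI exI[of _ "J \<union> J'"] exI[of _ d]) auto
qed

lemma L2_span_cmult:
  assumes "p \<in> L2_span I e"
  shows "(\<lambda>x. c * p x) \<in> L2_span I e"
proof -
  obtain J d where "finite J" "J \<subseteq> I" "p = (\<lambda>x. \<Sum>j\<in>J. d j * e j x)"
    using assms by (auto simp: L2_span_def)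
  then show ?thesis unfolding L2_span_def
    by (intro CollectI exI[of _ J] exI[of _ "\<lambda>j. c * d j"]) (auto simp: sum_distrib_left mult.assoc)
qed

locale L2_family =
  fixes M :: "'a measure" and I :: "'i set" and e :: "'i \<Rightarrow> 'a \<Rightarrow> complex"
  assumes e_L2: "i \<in> I \<Longrightarrow> e i \<in> L2_functions M"
begin

abbreviation "V \<equiv> L2_closed_span M I e"

lemma span_L2: "p \<in> L2_span I e \<Longrightarrow> p \<in> L2_functions M"
  using e_L2 by (auto simp: L2_span_def intro!: L2_functions_sum L2_functions_cmult)

lemma closed_span_L2: "f \<in> V \<Longrightarrow> f \<in> L2_functions M"
  by (simp add: L2_closed_span_def)

lemma closed_span_approx:
  assumes "f \<in> L2_functions M" and "\<And>\<epsilon>. 0 < \<epsilon> \<Longrightarrow> \<exists>g\<in>V. L2_sqnorm M (\<lambda>x. f x - g x) < \<epsilon>"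
  shows "f \<in> V"
  unfolding L2_closed_span_def
proof (intro CollectI conjI allI impI assms(1))
  fix \<epsilon> :: real assume \<epsilon>: "0 < \<epsilon>"
  \<comment> \<open>A quarter, because \<open>L2_sqnorm_add\<close> doubles each of the two squared
    norms.\<close>
  obtain g where g: "g \<in> V" "L2_sqnorm M (\<lambda>x. f x - g x) < \<epsilon> / 4" using assms(2)[of "\<epsilon> / 4"] \<epsilon> by auto
  obtain p where p: "p \<in> L2_span I e" "L2_sqnorm M (\<lambda>x. g x - p x) < \<epsilon> / 4"
    using g(1) \<epsilon> unfolding L2_closed_span_def by (auto dest!: spec[of _ "\<epsilon> / 4"])
  have "L2_sqnorm M (\<lambda>x. (f x - g x) + (g x - p x)) < \<epsilon>"
    using L2_sqnorm_add[OF L2_functions_diff[OF assms(1) closed_span_L2[OF g(1)]]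
        L2_functions_diff[OF closed_span_L2[OF g(1)] span_L2[OF p(1)]]] g p by linarith
  then show "\<exists>p\<in>L2_span I e. L2_sqnorm M (\<lambda>x. f x - p x) < \<epsilon>" using p(1) by auto
qed

lemma closed_span_add:
  assumes f: "f \<in> V" and g: "g \<in> V"
  shows "(\<lambda>x. f x + g x) \<in> V"
  unfolding L2_closed_span_def
proof (intro CollectI conjI allI impI L2_functions_add closed_span_L2 f g)
  fix \<epsilon> :: real assume \<epsilon>: "0 < \<epsilon>"
  obtain p where p: "p \<in> L2_span I e" "L2_sqnorm M (\<lambda>x. f x - p x) < \<epsilon> / 4"
    using f \<epsilon> unfolding L2_closed_span_def by (auto dest!: spec[of _ "\<epsilon> / 4"])
  obtain p' where p': "p' \<in> L2_span I e" "L2_sqnorm M (\<lambda>x. g x - p' x) < \<epsilon> / 4"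
    using g \<epsilon> unfolding L2_closed_span_def by (auto dest!: spec[of _ "\<epsilon> / 4"])
  have "L2_sqnorm M (\<lambda>x. (f x - p x) + (g x - p' x)) < \<epsilon>"
    using L2_sqnorm_add[OF L2_functions_diff[OF closed_span_L2[OF f] span_L2[OF p(1)]]
        L2_functions_diff[OF closed_span_L2[OF g] span_L2[OF p'(1)]]] p p' by linarith
  then show "\<exists>p\<in>L2_span I e. L2_sqnorm M (\<lambda>x. f x + g x - p x) < \<epsilon>"
    using L2_span_add[OF p(1) p'(1)] by (intro bexI[of _ "\<lambda>x. p x + p' x"]) (simp add: algebra_simps)
qed

lemma closed_span_cmult:
  assumes f: "f \<in> V"
  shows "(\<lambda>x. c * f x) \<in> V"
  unfolding L2_closed_span_def
proof (intro CollectI conjI allI impI L2_functions_cmult closed_span_L2 f)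
  fix \<epsilon> :: real assume \<epsilon>: "0 < \<epsilon>"
  \<comment> \<open>The added 1 keeps the divisor positive when c = 0.\<close>
  define d where "d = (cmod c)\<^sup>2 + 1"
  have d: "0 < d" "(cmod c)\<^sup>2 \<le> d" by (simp_all add: d_def add_nonneg_pos)
  then obtain p where p: "p \<in> L2_span I e" "L2_sqnorm M (\<lambda>x. f x - p x) < \<epsilon> / d"
    using f \<epsilon> unfolding L2_closed_span_def by (auto dest!: spec[of _ "\<epsilon> / d"])
  have "L2_sqnorm M (\<lambda>x. c * f x - c * p x) = (cmod c)\<^sup>2 * L2_sqnorm M (\<lambda>x. f x - p x)"
    by (simp add: L2_sqnorm_def right_diff_distrib[symmetric] norm_mult power_mult_distrib del: right_diff_distrib_numeral)
  also have "\<dots> \<le> d * L2_sqnorm M (\<lambda>x. f x - p x)"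
    using d by (intro mult_right_mono) (auto simp: L2_sqnorm_def)
  also have "\<dots> < \<epsilon>" using d p(2) by (simp add: field_simps)
  finally show "\<exists>p\<in>L2_span I e. L2_sqnorm M (\<lambda>x. c * f x - p x) < \<epsilon>"
    using L2_span_cmult[OF p(1)] by (intro bexI[of _ "\<lambda>x. c * p x"])
qed

lemma closed_span_0: "(\<lambda>x. 0) \<in> V"
proof -
  have "(\<lambda>x. 0) \<in> L2_span I e" unfolding L2_span_def by (intro CollectI exI[of _ "{}"]) auto
  then show ?thesis
    unfolding L2_closed_span_def by (auto intro!: L2_functionsI bexI[of _ "\<lambda>x. 0"] simp: L2_sqnorm_def)
qed

lemma closed_span_sum:
  assumes "\<And>i. i \<in> A \<Longrightarrow> f i \<in> V"
  shows "(\<lambda>x. \<Sum>i\<in>A. f i x) \<in> V"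
  using assms
proof (induction A rule: infinite_finite_induct)
  case (insert i A)
  then show ?case using closed_span_add[of "f i" "\<lambda>x. \<Sum>i\<in>A. f i x"] by simp
qed (simp_all add: closed_span_0)

text \<open>Dominated convergence in L2, reused for simple functions, half-lines and countable
  unions. As w dominates the squares of \<open>g n\<close> and hence of f, the squared differences
  are dominated by 4 w.\<close>

lemma closed_span_dominated:
  assumes f: "f \<in> borel_measurable M" and g: "\<And>n. g n \<in> V"
    and lim: "\<And>x. x \<in> space M \<Longrightarrow> (\<lambda>n. g n x) \<longlonglongrightarrow> f x"
    and w: "integrable M w" "\<And>n x. x \<in> space M \<Longrightarrow> (cmod (g n x))\<^sup>2 \<le> w x"
  shows "f \<in> V"
proof -
  have gm [measurable]: "g n \<in> borel_measurable M" for n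
    using closed_span_L2[OF g[of n]] by (simp add: L2_functions_def)
  note f[measurable]
  have fw: "(cmod (f x))\<^sup>2 \<le> w x" if "x \<in> space M" for x
    using LIMSEQ_le_const2[OF tendsto_power[OF tendsto_norm[OF lim[OF that]], of 2], of "w x"] w(2)[OF that] by auto
  have fL2: "f \<in> L2_functions M"
  proof (intro L2_functionsI f Bochner_Integration.integrable_bound[OF w(1)])
    show "AE x in M. norm ((cmod (f x))\<^sup>2) \<le> norm (w x)"
      using order_trans[OF fw abs_ge_self] by (intro AE_I2) simp
  qed measurable
  have "(\<lambda>n. L2_sqnorm M (\<lambda>x. f x - g n x)) \<longlonglongrightarrow> (LINT x|M. 0)"
    unfolding L2_sqnorm_def
  proof (rule integral_dominated_convergence[where w="\<lambda>x. 4 * w x"])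
    show "AE x in M. (\<lambda>n. (cmod (f x - g n x))\<^sup>2) \<longlonglongrightarrow> 0"
    proof (rule AE_I2)
      fix x assume "x \<in> space M"
      then have "(\<lambda>n. (cmod (f x - g n x))\<^sup>2) \<longlonglongrightarrow> (cmod (f x - f x))\<^sup>2"
        by (intro tendsto_intros lim)
      then show "(\<lambda>n. (cmod (f x - g n x))\<^sup>2) \<longlonglongrightarrow> 0" by simp
    qed
    show "AE x in M. norm ((cmod (f x - g n x))\<^sup>2) \<le> 4 * w x" for n
    proof (rule AE_I2)
      fix x assume x: "x \<in> space M"
      show "norm ((cmod (f x - g n x))\<^sup>2) \<le> 4 * w x"
        using cmod_add_square_le[of "f x" "- g n x"] fw[OF x] w(2)[OF x, of n] by simp
    qed
  qed (use w in auto)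
  then have to_0: "(\<lambda>n. L2_sqnorm M (\<lambda>x. f x - g n x)) \<longlonglongrightarrow> 0" by simp
  show ?thesis
  proof (rule closed_span_approx[OF fL2])
    fix \<epsilon> :: real assume "0 < \<epsilon>"
    then obtain n where "L2_sqnorm M (\<lambda>x. f x - g n x) < \<epsilon>"
      using order_tendstoD(2)[OF to_0] by (auto simp: eventually_sequentially)
    then show "\<exists>g\<in>V. L2_sqnorm M (\<lambda>x. f x - g x) < \<epsilon>" using g by (intro bexI[of _ "g n"])
  qed
qed

lemma L2_functions_subset_closed_span:
  assumes fin: "finite_measure M" and ind: "\<And>A. A \<in> sets M \<Longrightarrow> (indicator A :: 'a \<Rightarrow> complex) \<in> V"
  shows "L2_functions M \<subseteq> V"
proof
  fix f assume f: "f \<in> L2_functions M"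
  then have fm: "f \<in> borel_measurable M" by (simp add: L2_functions_def)
  obtain F where F: "\<And>i. simple_function M (F i)" "\<And>x. x \<in> space M \<Longrightarrow> (\<lambda>i. F i x) \<longlonglongrightarrow> f x"
      "\<And>i x. x \<in> space M \<Longrightarrow> norm (F i x) \<le> 2 * norm (f x)"
  proof -
    obtain F where "\<forall>i. simple_function M (F i)" "\<forall>x\<in>space M. (\<lambda>i. F i x) \<longlonglongrightarrow> f x"
        "\<forall>i. \<forall>x\<in>space M. dist (F i x) 0 \<le> 2 * dist (f x) 0"
      using borel_measurable_implies_sequence_metric[OF fm, of 0] by blast
    then show ?thesis by (intro that[of F]) simp_all
  qed
  \<comment> \<open>A simple function agrees with its indicator sum only on \<open>space M\<close>,
    so the limit lemma is applied to a constant sequence instead of rewriting the function.\<close>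
  have FV: "F i \<in> V" for i
  proof (rule closed_span_dominated[where g="\<lambda>_ x. \<Sum>y\<in>F i ` space M. y * indicator (F i -` {y} \<inter> space M) x"])
    show "F i \<in> borel_measurable M" using F(1) by (rule borel_measurable_simple_function)
    show "(\<lambda>x. \<Sum>y\<in>F i ` space M. y * indicator (F i -` {y} \<inter> space M) x) \<in> V"
      using F(1) by (intro closed_span_sum closed_span_cmult ind) (rule simple_functionD)
    have eq: "(\<Sum>y\<in>F i ` space M. y * indicator (F i -` {y} \<inter> space M) x) = F i x" if "x \<in> space M" for x
    proof -
      have "y * indicator A x = indicator A x *\<^sub>R y" for y :: complex and A
        by (simp add: indicator_def)
      then show ?thesis
        using simple_function_indicator_representation_banach[OF F(1) that, of i] by (simp only:)
    qed
    show "(\<lambda>n. \<Sum>y\<in>F i ` space M. y * indicator (F i -` {y} \<inter> space M) x) \<longlonglongrightarrow> F i x" if "x \<in> space M" for x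
      using eq[OF that] by simp
    show "(cmod (\<Sum>y\<in>F i ` space M. y * indicator (F i -` {y} \<inter> space M) x))\<^sup>2 \<le> 4 * (cmod (f x))\<^sup>2"
      if "x \<in> space M" for x
      using power_mono[OF F(3)[OF that], of i 2] eq[OF that] by (simp add: power_mult_distrib)
    show "integrable M (\<lambda>x. 4 * (cmod (f x))\<^sup>2)" using f by (simp add: L2_functions_def)
  qed
  show "f \<in> V"
  proof (rule closed_span_dominated[OF fm FV F(2)])
    show "integrable M (\<lambda>x. 4 * (cmod (f x))\<^sup>2)" using f by (simp add: L2_functions_def)
    show "(cmod (F i x))\<^sup>2 \<le> 4 * (cmod (f x))\<^sup>2" if "x \<in> space M" for i x
      using power_mono[OF F(3)[OF that], of i 2] by (simp add: power_mult_distrib)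
  qed
qed

end

section \<open>Trigonometric polynomials\<close>

inductive trig_poly :: "(real \<Rightarrow> complex) \<Rightarrow> bool" where
  monomial: "trig_poly (\<lambda>x. c * iexp (u * x))"
| add: "trig_poly f \<Longrightarrow> trig_poly g \<Longrightarrow> trig_poly (\<lambda>x. f x + g x)"

lemma trig_poly_monomial_mult: "trig_poly g \<Longrightarrow> trig_poly (\<lambda>x. (c * iexp (u * x)) * g x)"
proof (induction rule: trig_poly.induct)
  case (monomial d v)
  have "(\<lambda>x. c * iexp (u * x) * (d * iexp (v * x))) = (\<lambda>x. (c * d) * iexp ((u + v) * x))"
    by (auto simp: exp_add[symmetric] algebra_simps)
  then show ?case using trig_poly.monomial[of "c * d" "u + v"] by simp
next
  case (add f g)
  then show ?case by (simp only: distrib_left trig_poly.add)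
qed

lemma trig_poly_mult: "trig_poly f \<Longrightarrow> trig_poly g \<Longrightarrow> trig_poly (\<lambda>x. f x * g x)"
proof (induction rule: trig_poly.induct)
  case (monomial c u)
  then show ?case by (rule trig_poly_monomial_mult)
next
  case (add f g')
  then show ?case by (simp only: distrib_right trig_poly.add)
qed

lemma continuous_on_trig_poly: "trig_poly f \<Longrightarrow> continuous_on A f"
  by (induction rule: trig_poly.induct) (auto intro!: continuous_intros)

text \<open>Stone-Weierstrass for real functions that are trigonometric polynomials. Frequencies are
  arbitrary reals, so the cosine itself is available; it is injective on [0, \<pi>] and separates
  even 0 from 1, unlike functions of period 1.\<close>

lemma trig_poly_dense:
  fixes g :: "real \<Rightarrow> real"
  assumes "continuous_on {0..1} g" "0 < \<epsilon>"
  obtains p where "trig_poly p" "\<And>x. x \<in> {0..1} \<Longrightarrow> cmod (of_real (g x) - p x) < \<epsilon>"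
proof -
  let ?R = "{f :: real \<Rightarrow> real. trig_poly (\<lambda>x. of_real (f x))}"
  interpret function_ring_on ?R "{0..1}"
  proof
    show "continuous_on {0..1} f" if "f \<in> ?R" for f
      using continuous_on_Re[OF continuous_on_trig_poly[of "\<lambda>x. of_real (f x)" "{0..1}"]] that by simp
    show "(\<lambda>_. c) \<in> ?R" for c using trig_poly.monomial[of "of_real c" 0] by simp
    fix x y :: real assume xy: "x \<in> {0..1}" "y \<in> {0..1}" "x \<noteq> y"
    have "(\<lambda>x. of_real (cos x)) = (\<lambda>x. 1 / 2 * iexp (1 * x) + 1 / 2 * iexp (- 1 * x))"
      by (auto simp: cos_of_real[symmetric] cos_exp_eq)
    then have "trig_poly (\<lambda>x. of_real (cos x))"
      by (simp only:) (intro trig_poly.add trig_poly.monomial)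
    then have "cos \<in> ?R" by simp
    moreover have "cos x \<noteq> cos y"
      using xy pi_gt3 by (auto dest: cos_inj_pi)
    ultimately show "\<exists>f\<in>?R. f x \<noteq> f y" by blast
  qed (auto intro: trig_poly.add trig_poly_mult)
  obtain h where h: "h \<in> ?R" "\<And>x. x \<in> {0..1} \<Longrightarrow> \<bar>g x - h x\<bar> < \<epsilon>"
    using Stone_Weierstrass_basic[OF assms] by blast
  have "cmod (of_real (g x) - of_real (h x)) < \<epsilon>" if "x \<in> {0..1}" for x
    using h(2)[OF that] by (simp flip: of_real_diff)
  then show ?thesis using h(1) by (intro that) auto
qed

section \<open>Inner products and Bessel's identity\<close>

lemma integrable_L2_product:
  assumes "f \<in> L2_functions M" "g \<in> L2_functions M"
  shows "integrable M (\<lambda>x. f x * cnj (g x))"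
proof (rule Bochner_Integration.integrable_bound)
  have [measurable]: "f \<in> borel_measurable M" "g \<in> borel_measurable M" using assms by (auto simp: L2_functions_def)
  show "integrable M (\<lambda>x. (cmod (f x))\<^sup>2 + (cmod (g x))\<^sup>2)"
    using assms by (auto simp: L2_functions_def)
  have [measurable]: "cnj \<in> borel_measurable borel" by (intro borel_measurable_continuous_onI continuous_intros)
  show "(\<lambda>x. f x * cnj (g x)) \<in> borel_measurable M" by measurable
  have "a * b \<le> a\<^sup>2 + b\<^sup>2" for a b :: real
    using sum_squares_bound[of a b] zero_le_power2[of a] zero_le_power2[of b] by linarith
  then show "AE x in M. norm (f x * cnj (g x)) \<le> norm ((cmod (f x))\<^sup>2 + (cmod (g x))\<^sup>2)"
    by (simp add: norm_mult)
qed

lemma L2_inner_cnj: "L2_inner M g f = cnj (L2_inner M f g)"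
  using Bochner_Integration.integral_cnj[of M "\<lambda>x. f x * cnj (g x)"] by (simp add: L2_inner_def mult.commute)

text \<open>Bessel's identity, obtained by expanding the square: both mixed sums and the double sum
  reduce to the same sum of squared coefficients.\<close>

lemma L2_sqnorm_diff_projection:
  assumes f: "f \<in> L2_functions M" and J: "finite J" "\<And>j. j \<in> J \<Longrightarrow> e j \<in> L2_functions M"
    and on: "\<And>i j. i \<in> J \<Longrightarrow> j \<in> J \<Longrightarrow> L2_inner M (e i) (e j) = (if i = j then 1 else 0)"
  shows "L2_sqnorm M (\<lambda>x. f x - (\<Sum>j\<in>J. L2_inner M f (e j) * e j x)) =
    L2_sqnorm M f - (\<Sum>j\<in>J. (cmod (L2_inner M f (e j)))\<^sup>2)"
proof -
  define c where "c j = L2_inner M f (e j)" for j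
  have sq: "complex_of_real (L2_sqnorm M h) = (LINT x|M. h x * cnj (h x))" for h
    unfolding L2_sqnorm_def integral_complex_of_real[symmetric] complex_norm_square ..
  note int = integrable_L2_product[OF f f] integrable_L2_product[OF f J(2)]
    integrable_L2_product[OF J(2) f] integrable_L2_product[OF J(2) J(2)]
  have "complex_of_real (L2_sqnorm M (\<lambda>x. f x - (\<Sum>j\<in>J. c j * e j x))) =
      (LINT x|M. f x * cnj (f x) - (\<Sum>j\<in>J. cnj (c j) * (f x * cnj (e j x)))
        - (\<Sum>j\<in>J. c j * (e j x * cnj (f x))) + (\<Sum>i\<in>J. \<Sum>j\<in>J. c i * cnj (c j) * (e i x * cnj (e j x))))"
    unfolding sq
    by (intro Bochner_Integration.integral_cong refl)
      (simp add: algebra_simps sum_distrib_left sum_distrib_right sum_product, rule sum.swap)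
  also have "\<dots> = L2_inner M f f - (\<Sum>j\<in>J. cnj (c j) * L2_inner M f (e j))
        - (\<Sum>j\<in>J. c j * L2_inner M (e j) f) + (\<Sum>i\<in>J. \<Sum>j\<in>J. c i * cnj (c j) * L2_inner M (e i) (e j))"
    using int by (simp add: L2_inner_def)
  also have "(\<Sum>i\<in>J. \<Sum>j\<in>J. c i * cnj (c j) * L2_inner M (e i) (e j)) = (\<Sum>i\<in>J. c i * cnj (c i))"
    using J(1) by (simp add: on sum.delta' if_distrib[of "\<lambda>z. _ * z"] cong: if_cong)
  also have "(\<Sum>j\<in>J. c j * L2_inner M (e j) f) = (\<Sum>i\<in>J. c i * cnj (c i))"
    unfolding L2_inner_cnj[of M "e _" f] c_def ..
  also have "(\<Sum>j\<in>J. cnj (c j) * L2_inner M f (e j)) = (\<Sum>i\<in>J. c i * cnj (c i))"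
    unfolding c_def by (simp add: mult.commute)
  also have "(\<Sum>i\<in>J. c i * cnj (c i)) = complex_of_real (\<Sum>j\<in>J. (cmod (c j))\<^sup>2)"
    by (simp only: of_real_sum complex_norm_square)
  also have "L2_inner M f f = complex_of_real (L2_sqnorm M f)" by (simp add: sq L2_inner_def)
  finally have "complex_of_real (L2_sqnorm M (\<lambda>x. f x - (\<Sum>j\<in>J. c j * e j x))) =
      complex_of_real (L2_sqnorm M f - (\<Sum>j\<in>J. (cmod (c j))\<^sup>2))" by simp
  then show ?thesis unfolding c_def of_real_eq_iff .
qed

section \<open>Exponentials and their orthonormality\<close>

definition exponential :: "real \<Rightarrow> real \<Rightarrow> complex" where
  "exponential l x = exp (- 2 * of_real pi * \<i> * of_real (l \<bullet> x))"

lemma exponential_eq_iexp: "exponential l x = iexp ((- 2 * pi * l) * x)"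
  by (simp add: exponential_def mult_ac)

lemma L2_inner_exponential: "L2_inner M (exponential a) (exponential b) = char M (- 2 * pi * (a - b))"
proof -
  have "exponential a x * cnj (exponential b x) = iexp ((- 2 * pi * (a - b)) * x)" for x
    unfolding exponential_eq_iexp exp_cnj by (simp add: exp_add[symmetric] algebra_simps)
  then show ?thesis by (simp only: L2_inner_def char_def)
qed

lemma cmod_exponential [simp]: "cmod (exponential l x) = 1"
  unfolding exponential_eq_iexp by (simp only: norm_exp_i_times)

lemma borel_measurable_exponential [measurable]: "exponential l \<in> borel_measurable borel"
  unfolding exponential_def by measurable

definition all_frequencies :: "nat set \<Rightarrow> real set" where
  "all_frequencies S = (\<Union>n. frequencies S n)"

lemma exponential_L2: "exponential l \<in> L2_functions (digit_measure S)"
proof -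
  interpret real_distribution "digit_measure S" by (rule real_distribution_digit_measure)
  show ?thesis by (intro L2_functionsI) (simp_all add: measurable_cong_sets[OF sets_digit_measure refl])
qed

text \<open>A finite level decides orthogonality: the mask vanishes at a level containing both
  frequencies, and the squared inner product lies between 0 and that mask.\<close>

lemma exponential_orthonormal:
  assumes "a \<in> all_frequencies S" "b \<in> all_frequencies S"
  shows "L2_inner (digit_measure S) (exponential a) (exponential b) = (if a = b then 1 else 0)"
proof (cases "a = b")
  case True
  then show ?thesis
    using real_distribution.char_zero[OF real_distribution_digit_measure] by (simp add: L2_inner_exponential)
next
  case False
  obtain m n where "a \<in> frequencies S m" "b \<in> frequencies S n" using assms by (auto simp: all_frequencies_def)
  then have "a \<in> frequencies S (max m n)" "b \<in> frequencies S (max m n)"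
    using frequencies_mono[of m "max m n" S] frequencies_mono[of n "max m n" S] by auto
  then have "mask S (max m n) (a - b) = 0" using False by (intro mask_diff_frequencies)
  then have "spectral_mask S (a - b) = 0"
    using spectral_mask_le[of S "a - b" "max m n"] spectral_mask_nonneg[of S "a - b"] by simp
  then show ?thesis using False by (simp add: L2_inner_exponential spectral_mask_def)
qed

lemma spectral_mask_minus: "spectral_mask S (- x) = spectral_mask S x"
proof -
  have "mask S n (- x) = mask S n x" for n by (simp add: mask_def)
  then show ?thesis using mask_tendsto[of S "- x"] mask_tendsto[of S x] by (simp add: LIMSEQ_unique)
qed

lemma AE_digit_measure_unit: "AE x in digit_measure S. x \<in> {0..1}"
proof -
  have "emeasure (digit_measure S) (- {0..1}) = 0"
    using expansion_unit[of S] by (intro emeasure_digit_measure_eq_0) auto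
  then show ?thesis by (intro AE_I[of _ _ "- {0..1}"]) auto
qed

section \<open>Completeness of the spectrum\<close>

context
  fixes S :: "nat set"
  assumes S: "infinite (- S)"
begin

interpretation real_distribution "digit_measure S"
  by (rule real_distribution_digit_measure)

interpretation L2_family "digit_measure S" "all_frequencies S" exponential
  by unfold_locales (rule exponential_L2)

text \<open>By Bessel's identity the squared distance from \<open>exponential y\<close> to the span
  of level m is 1 minus the sum of \<open>spectral_mask S (l - y)\<close>, which the completeness
  criterion makes small. The frequency y is an arbitrary real.\<close>

lemma exponential_in_closed_span: "exponential y \<in> V"
  unfolding L2_closed_span_def
proof (intro CollectI conjI allI impI exponential_L2)
  fix \<epsilon> :: real assume \<epsilon>: "0 < \<epsilon>"
  obtain m where m: "1 - \<epsilon> < (\<Sum>l\<in>frequencies S m. spectral_mask S (- y + l))"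
    using sum_spectral_mask[OF S \<epsilon>] by blast
  define p where "p x = (\<Sum>l\<in>frequencies S m. L2_inner (digit_measure S) (exponential y) (exponential l) * exponential l x)" for x
  have sub: "frequencies S m \<subseteq> all_frequencies S" by (auto simp: all_frequencies_def)
  have "L2_sqnorm (digit_measure S) (\<lambda>x. exponential y x - p x) = L2_sqnorm (digit_measure S) (exponential y)
      - (\<Sum>l\<in>frequencies S m. (cmod (L2_inner (digit_measure S) (exponential y) (exponential l)))\<^sup>2)"
    unfolding p_def using sub
    by (intro L2_sqnorm_diff_projection exponential_L2 finite_frequencies exponential_orthonormal) auto
  also have "L2_sqnorm (digit_measure S) (exponential y) = 1"
    using prob_space by (simp add: L2_sqnorm_def)
  also have "(\<Sum>l\<in>frequencies S m. (cmod (L2_inner (digit_measure S) (exponential y) (exponential l)))\<^sup>2) =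
      (\<Sum>l\<in>frequencies S m. spectral_mask S (- y + l))"
  proof (rule sum.cong[OF refl])
    fix l
    show "(cmod (L2_inner (digit_measure S) (exponential y) (exponential l)))\<^sup>2 = spectral_mask S (- y + l)"
      using spectral_mask_minus[of S "y - l"] by (simp add: L2_inner_exponential spectral_mask_def)
  qed
  finally have "L2_sqnorm (digit_measure S) (\<lambda>x. exponential y x - p x) < \<epsilon>" using m by simp
  moreover have "p \<in> L2_span (all_frequencies S) exponential"
    unfolding L2_span_def p_def[abs_def] using sub by (intro CollectI exI[of _ "frequencies S m"] exI) auto
  ultimately show "\<exists>p\<in>L2_span (all_frequencies S) exponential. L2_sqnorm (digit_measure S) (\<lambda>x. exponential y x - p x) < \<epsilon>"
    by blast
qed

lemma trig_poly_in_closed_span: "trig_poly p \<Longrightarrow> p \<in> V"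
proof (induction rule: trig_poly.induct)
  case (monomial c u)
  have "(\<lambda>x. c * iexp (u * x)) = (\<lambda>x. c * exponential (- u / (2 * pi)) x)"
    by (simp add: exponential_eq_iexp)
  then show ?case using closed_span_cmult[OF exponential_in_closed_span] by simp
next
  case (add f g)
  then show ?case by (intro closed_span_add)
qed

lemma continuous_in_closed_span:
  fixes g :: "real \<Rightarrow> real"
  assumes g: "continuous_on UNIV g" "\<And>x. 0 \<le> g x \<and> g x \<le> 1"
  shows "(\<lambda>x. complex_of_real (g x)) \<in> V"
proof (rule closed_span_approx)
  have gm [measurable]: "g \<in> borel_measurable borel" using g(1) by (rule borel_measurable_continuous_onI)
  show L2: "(\<lambda>x. complex_of_real (g x)) \<in> L2_functions (digit_measure S)"
  proof (rule L2_functionsI)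
    show "integrable (digit_measure S) (\<lambda>x. (cmod (complex_of_real (g x)))\<^sup>2)"
      using g(2) by (intro integrable_const_bound[where B=1]) (auto simp: abs_square_le_1 abs_le_iff intro: order_trans[of _ 0])
  qed measurable
  fix \<epsilon> :: real assume \<epsilon>: "0 < \<epsilon>"
  \<comment> \<open>d \<le> 1 passes from the uniform error to its square: d^2 \<le> d < \<epsilon>.
    Uniform closeness on [0, 1] is enough since the measure lives there.\<close>
  define d where "d = min 1 \<epsilon> / 2"
  have d: "0 < d" "d \<le> 1" "d < \<epsilon>" using \<epsilon> by (auto simp: d_def)
  obtain p where p: "trig_poly p" "\<And>x. x \<in> {0..1} \<Longrightarrow> cmod (of_real (g x) - p x) < d"
    using trig_poly_dense[OF continuous_on_subset[OF g(1) subset_UNIV] d(1)] by blast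
  have pV: "p \<in> V" using p(1) by (rule trig_poly_in_closed_span)
  have "L2_sqnorm (digit_measure S) (\<lambda>x. of_real (g x) - p x) \<le> (LINT x|digit_measure S. d)"
    unfolding L2_sqnorm_def
  proof (rule integral_mono_AE)
    show "integrable (digit_measure S) (\<lambda>x. (cmod (of_real (g x) - p x))\<^sup>2)"
      using L2_functions_diff[OF L2 closed_span_L2[OF pV]] by (simp add: L2_functions_def)
    show "AE x in digit_measure S. (cmod (of_real (g x) - p x))\<^sup>2 \<le> d"
      using AE_digit_measure_unit[of S]
    proof eventually_elim
      fix x :: real assume "x \<in> {0..1}"
      then have "cmod (of_real (g x) - p x) \<le> d" using p(2) by (simp add: less_imp_le)
      then have "(cmod (of_real (g x) - p x))\<^sup>2 \<le> d\<^sup>2" by (intro power_mono) auto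
      also have "\<dots> \<le> d" using d by (simp add: power2_eq_square mult_left_le)
      finally show "(cmod (of_real (g x) - p x))\<^sup>2 \<le> d" .
    qed
  qed simp
  also have "\<dots> = d" using prob_space by simp
  finally show "\<exists>p\<in>V. L2_sqnorm (digit_measure S) (\<lambda>x. of_real (g x) - p x) < \<epsilon>"
    using pV d(3) by (intro bexI[of _ p]) auto
qed

lemma indicator_atMost_in_closed_span: "(indicator {..a} :: real \<Rightarrow> complex) \<in> V"
proof (rule closed_span_dominated[where w="\<lambda>_. 1"])
  \<comment> \<open>For positive n a continuous ramp, equal to 1 up to a and falling to 0 at a + 1 /
    n.\<close>
  define g where "g n x = max 0 (min 1 (1 - real n * (x - a)))" for n x
  show "(\<lambda>x. complex_of_real (g n x)) \<in> V" for n
    by (rule continuous_in_closed_span) (auto simp: g_def intro!: continuous_intros)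
  show "(cmod (complex_of_real (g n x)))\<^sup>2 \<le> 1" for n x
    by (simp add: abs_square_le_1 g_def)
  fix x :: real
  show "(\<lambda>n. complex_of_real (g n x)) \<longlonglongrightarrow> indicator {..a} x"
  proof (cases "x \<le> a")
    case True
    then have "g n x = 1" for n
      by (auto simp: g_def min_def max_def mult_nonneg_nonpos)
    then show ?thesis using True by simp
  next
    case False
    then obtain N :: nat where N: "1 / (x - a) < N" using reals_Archimedean2 by blast
    have "g n x = 0" if "n \<ge> N" for n
    proof -
      have "1 < real N * (x - a)" using N False by (simp add: pos_divide_less_eq)
      also have "\<dots> \<le> real n * (x - a)" using that False by (intro mult_right_mono) auto
      finally show ?thesis by (simp add: g_def)
    qed
    then have "eventually (\<lambda>n. complex_of_real (g n x) = indicator {..a} x) sequentially"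
      using False by (auto simp: eventually_sequentially intro!: exI[of _ N])
    then show ?thesis by (rule tendsto_eventually)
  qed
qed auto

text \<open>Dynkin's argument: half-lines are an intersection-stable generator, and the sets with
  indicator in \<open>V\<close> are closed under complements and countable disjoint unions.\<close>

lemma indicator_in_closed_span:
  assumes "A \<in> sets borel"
  shows "(indicator A :: real \<Rightarrow> complex) \<in> V"
proof -
  have one: "(\<lambda>_. 1) \<in> V"
    using exponential_in_closed_span[of 0] by (simp add: exponential_def[abs_def])
  have "Int_stable (range (\<lambda>a::real. {..a}))" by (auto simp: Int_stable_def)
  moreover have "range (\<lambda>a::real. {..a}) \<subseteq> Pow UNIV" by auto
  moreover have "A \<in> sigma_sets UNIV (range (\<lambda>a. {..a}))"
    using assms by (simp add: borel_eq_atMost)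
  ultimately show ?thesis
  proof (induction rule: sigma_sets_induct_disjoint)
    case (basic A)
    then show ?case using indicator_atMost_in_closed_span by auto
  next
    case empty
    then show ?case using closed_span_0 by simp
  next
    case (compl A)
    have "(indicator (UNIV - A) :: real \<Rightarrow> complex) = (\<lambda>x. 1 + (- 1) * indicator A x)"
      by (auto simp: indicator_def)
    then show ?case using closed_span_add[OF one closed_span_cmult[OF compl(2)]] by (simp only:)
  next
    case (union A)
    have A: "A i \<in> sets borel" for i using union(2) by (auto simp: borel_eq_atMost)
    show ?case
    proof (rule closed_span_dominated[where g="\<lambda>n. indicator (\<Union>i<n. A i)" and w="\<lambda>_. 1"])
      show "(indicator (\<Union>i. A i) :: real \<Rightarrow> complex) \<in> borel_measurable (digit_measure S)"
        using A by (intro borel_measurable_indicator) auto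
      have "(indicator (\<Union>i<n. A i) :: real \<Rightarrow> complex) = (\<lambda>x. \<Sum>i<n. indicator (A i) x)" for n
        using union(1) by (intro ext indicator_UN_disjoint) (auto simp: disjoint_family_on_def)
      then show "(indicator (\<Union>i<n. A i) :: real \<Rightarrow> complex) \<in> V" for n
        using closed_span_sum[of "{..<n}" "\<lambda>i. indicator (A i)"] union(3) by simp
      show "(\<lambda>n. indicator (\<Union>i<n. A i) x :: complex) \<longlonglongrightarrow> indicator (\<Union>i. A i) x" for x
        by (rule LIMSEQ_indicator_UN)
    qed (auto simp: indicator_def)
  qed
qed

lemma spectral_measure_digit_measure: "spectral_measure (digit_measure S)"
  unfolding spectral_measure_def
proof (intro conjI exI)
  show "prob_space (digit_measure S)" by (rule prob_space_axioms)
  show "compact (measure_support (digit_measure S))"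
    using closed_measure_support support_digit_measure_unit
    by (meson bounded_closed_interval bounded_subset compact_eq_bounded_closed)
  show "countable (all_frequencies S)"
    unfolding all_frequencies_def by (auto intro!: countable_UN intro: countable_finite)
  have dense: "\<exists>J c. finite J \<and> J \<subseteq> all_frequencies S \<and>
      L2_norm (digit_measure S) (\<lambda>x. f x - (\<Sum>j\<in>J. c j * exponential j x)) < \<epsilon>"
    if f: "f \<in> L2_functions (digit_measure S)" and \<epsilon>: "0 < \<epsilon>" for f \<epsilon>
  proof -
    have "f \<in> V"
      using L2_functions_subset_closed_span indicator_in_closed_span f finite_measure_axioms by auto
    then obtain p where p: "p \<in> L2_span (all_frequencies S) exponential"
        "L2_sqnorm (digit_measure S) (\<lambda>x. f x - p x) < \<epsilon>\<^sup>2"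
      using \<epsilon> unfolding L2_closed_span_def by (auto dest!: spec[of _ "\<epsilon>\<^sup>2"])
    have "L2_norm (digit_measure S) (\<lambda>x. f x - p x) < \<epsilon>"
      unfolding L2_norm_def using p(2) \<epsilon> by (intro real_less_lsqrt) (auto simp: L2_sqnorm_def)
    then show ?thesis using p(1) by (auto simp: L2_span_def)
  qed
  \<comment> \<open>\<open>exponential\<close> repeats the term in \<open>spectral_measure\<close>
    verbatim, inner product included, so it can be folded in directly.\<close>
  show "L2_orthonormal_basis (digit_measure S) (all_frequencies S)
      (\<lambda>l x. exp (- 2 * of_real pi * \<i> * of_real (l \<bullet> x)))"
    unfolding L2_orthonormal_basis_def exponential_def[symmetric]
    by (intro conjI ballI allI impI exponential_L2 exponential_orthonormal dense)
qed simp

end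

theorem theorem1p6:
  fixes t :: real
  assumes "t \<in> {0..1}"
  shows "\<exists>\<mu> :: real measure. moran_measure \<mu> \<and> spectral_measure \<mu> \<and>
    lower_dim \<mu> = ereal t \<and> measure_hausdorff_dim \<mu> = ereal t \<and>
    measure_packing_dim \<mu> = ereal t \<and> assouad_dim \<mu> = ereal t"
proof -
  obtain S where S: "infinite S" "infinite (- S)" "0 \<notin> S" "uniform_density S t"
    using ex_uniform_density[of t] assms by auto
  then have "S \<noteq> {}" by auto
  then interpret uniform_dimension "digit_measure S" t
    using uniform_dimension_digit_measure[of t S] S(4) assms by simp
  show ?thesis
    using moran_measure_digit_measure[OF S(1-3)] spectral_measure_digit_measure[OF S(2)]
      lower_dim_eq measure_hausdorff_dim_eq measure_packing_dim_eq assouad_dim_eq by blast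
qed

end
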